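(* The space of quasi-convex functions $f:\mathbb{R}^{2\times2}\to\mathbb{R}$ of linear growth is not separable with respect to the distance $(f,g)\mapsto\|Tf-Tg\|_{\infty,\mathbb{B}^{2\times2}}$.
   Context: A function $f:\mathbb{R}^{m\times n}\to\mathbb{R}$ has linear growth if $|f(z)|\le C(1+|z|)$ for some $C\geq 0$ and all $z$. A continuous $f:\mathbb{R}^{m\times n}\to\mathbb{R}$ is quasi-convex if $\int_D f(z+D\phi(x))\,dx\ge|D|f(z)$ for all $z\in\mathbb{R}^{m\times n}$, all bounded open $D\subset\mathbb{R}^n$ and all $\phi\in C_c^\infty(D,\mathbb{R}^m)$. $\mathbb{B}^{2\times 2}$ is the open unit ball of $\mathbb{R}^{2\times2}$ (Euclidean norm) and $Tf(\hat z)=(1-|\hat z|)f\big(\frac{\hat z}{1-|\hat z|}\big)$ for $\hat z\in\mathbb{B}^{2\times2}$; thus $\|Tf\|_{\infty,\mathbb{B}^{2\times2}}=\sup_{z}\frac{|f(z)|}{1+|z|}$. *)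

theory Defs
  imports "HOL-Analysis.Analysis"
begin

definition linear_growth :: "(real^'n^'m \<Rightarrow> real) \<Rightarrow> bool" where
  "linear_growth f \<longleftrightarrow> (\<exists>C\<ge>0. \<forall>z. \<bar>f z\<bar> \<le> C * (1 + norm z))"

text \<open>
  In finite dimension this is the usual class of \<open>k\<close> times continuously differentiable maps
  on the whole space: a differentiable map is of class \<open>Suc k\<close> iff all its directional
  derivatives are of class \<open>k\<close>.
\<close>

primrec C_k :: "nat \<Rightarrow> ('a::euclidean_space \<Rightarrow> 'b::real_normed_vector) \<Rightarrow> bool" where
  "C_k 0 f \<longleftrightarrow> continuous_on UNIV f"
| "C_k (Suc k) f \<longleftrightarrow> (\<forall>x. f differentiable (at x)) \<and>
     (\<forall>v. C_k k (\<lambda>x. frechet_derivative f (at x) v))"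

text \<open>Elements of \<open>C\<^sub>c\<^sup>\<infinity>(D, \<real>\<^sup>m)\<close> are extended by \<open>0\<close> outside \<open>D\<close>.\<close>

definition smooth_compact_support ::
    "'a::euclidean_space set \<Rightarrow> ('a \<Rightarrow> 'b::real_normed_vector) set" where
  "smooth_compact_support D =
     {\<phi>. (\<forall>k. C_k k \<phi>) \<and> compact (closure {x. \<phi> x \<noteq> 0}) \<and> closure {x. \<phi> x \<noteq> 0} \<subseteq> D}"

definition jacobian_matrix :: "(real^'n \<Rightarrow> real^'m) \<Rightarrow> real^'n \<Rightarrow> real^'n^'m" where
  "jacobian_matrix \<phi> x = matrix (frechet_derivative \<phi> (at x))"

definition quasi_convex :: "(real^'n^'m \<Rightarrow> real) \<Rightarrow> bool" where
  "quasi_convex f \<longleftrightarrow> continuous_on UNIV f \<and>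
     (\<forall>z D. \<forall>\<phi>\<in>smooth_compact_support D. open D \<longrightarrow> bounded D \<longrightarrow>
        (LINT x:D|lborel. f (z + jacobian_matrix \<phi> x)) \<ge> measure lborel D * f z)"

definition T :: "(real^'n^'m \<Rightarrow> real) \<Rightarrow> real^'n^'m \<Rightarrow> real" where
  "T f z = (1 - norm z) * f (z /\<^sub>R (1 - norm z))"

text \<open>
  The supremum is a genuine one only for bounded \<open>T f - T g\<close>; the value \<open>0\<close> outside the
  functions of linear growth is a convention (as in the library's \<open>fdist\<close>), needed
  because \<^locale>\<open>Metric_space\<close> asks for a distance that is nonnegative on the whole type.
\<close>

definition T_dist :: "(real^'n^'m \<Rightarrow> real) \<Rightarrow> (real^'n^'m \<Rightarrow> real) \<Rightarrow> real" where
  "T_dist f g = (if linear_growth f \<and> linear_growth g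
     then (SUP z\<in>ball 0 1. \<bar>T f z - T g z\<bar>) else 0)"

definition quasi_convex_linear_growth :: "(real^'n^'m \<Rightarrow> real) set" where
  "quasi_convex_linear_growth = {f. quasi_convex f \<and> linear_growth f}"

lemma linear_growth_T_bounded:
  assumes "linear_growth f"
  obtains C where "\<And>z. z \<in> ball 0 1 \<Longrightarrow> \<bar>T f z\<bar> \<le> C"
proof -
  obtain C where C: "\<And>z. \<bar>f z\<bar> \<le> C * (1 + norm z)"
    using assms unfolding linear_growth_def by blast
  have "\<bar>T f z\<bar> \<le> C" if "z \<in> ball 0 1" for z
  proof -
    have z: "norm z < 1" using that by simp
    have "\<bar>T f z\<bar> = (1 - norm z) * \<bar>f (z /\<^sub>R (1 - norm z))\<bar>"
      using z by (simp add: T_def abs_mult)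
    also have "\<dots> \<le> (1 - norm z) * (C * (1 + norm (z /\<^sub>R (1 - norm z))))"
      using z C[of "z /\<^sub>R (1 - norm z)"] by (intro mult_left_mono) simp_all
    also have "\<dots> = C"
      using z by (simp add: field_simps)
    finally show ?thesis .
  qed
  then show ?thesis using that by blast
qed

lemma T_dist_bdd_above:
  assumes "linear_growth f" "linear_growth g"
  shows "bdd_above ((\<lambda>z. \<bar>T f z - T g z\<bar>) ` ball 0 1)"
proof -
  obtain A B where AB: "\<And>z. z \<in> ball 0 1 \<Longrightarrow> \<bar>T f z\<bar> \<le> A" "\<And>z. z \<in> ball 0 1 \<Longrightarrow> \<bar>T g z\<bar> \<le> B"
    using assms linear_growth_T_bounded by metis
  show ?thesis
  proof (rule bdd_aboveI2)
    fix z :: "real^'a^'b" assume "z \<in> ball 0 1"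
    then show "\<bar>T f z - T g z\<bar> \<le> A + B"
      using AB[of z] by linarith
  qed
qed

lemma T_dist_upper:
  assumes "linear_growth f" "linear_growth g" "z \<in> ball 0 1"
  shows "\<bar>T f z - T g z\<bar> \<le> T_dist f g"
  using cSUP_upper[OF assms(3) T_dist_bdd_above[OF assms(1,2)]] assms by (simp add: T_dist_def)

lemma T_dist_least:
  assumes "linear_growth f" "linear_growth g" "\<And>z. z \<in> ball 0 1 \<Longrightarrow> \<bar>T f z - T g z\<bar> \<le> c"
  shows "T_dist f g \<le> c"
proof -
  have "(SUP z\<in>ball 0 1. \<bar>T f z - T g z\<bar>) \<le> c"
    by (rule cSUP_least) (use assms(3) in auto)
  then show ?thesis using assms by (simp add: T_dist_def)
qed

lemma T_inj:
  fixes f g :: "real^'a^'b \<Rightarrow> real"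
  assumes "\<And>z. z \<in> ball 0 1 \<Longrightarrow> T f z = T g z"
  shows "f = g"
proof
  fix w :: "real^'a^'b"
  define z where "z = w /\<^sub>R (1 + norm w)"
  have p: "1 + norm w > 0" by (simp add: add_pos_nonneg)
  have nz: "norm z = norm w / (1 + norm w)"
    using p by (simp add: z_def divide_inverse mult.commute)
  have n: "1 - norm z = 1 / (1 + norm w)"
    unfolding nz using p by (simp add: field_simps)
  then have "norm z < 1" using p by (smt (verit) divide_pos_pos)
  moreover have "z /\<^sub>R (1 - norm z) = w"
    unfolding n using p by (simp add: z_def)
  ultimately show "f w = g w"
    using assms[of z] by (simp add: T_def)
qed

lemma Metric_space_T_dist:
  "Metric_space (quasi_convex_linear_growth :: (real^'n^'m \<Rightarrow> real) set) T_dist"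
proof
  fix f g h :: "real^'n^'m \<Rightarrow> real"
  have "0 \<le> T_dist f g" if "linear_growth f" "linear_growth g"
    using T_dist_upper[OF that, of 0] by simp
  then show nonneg: "0 \<le> T_dist f g"
    by (cases "linear_growth f \<and> linear_growth g") (auto simp: T_dist_def)
  show "T_dist f g = T_dist g f"
    by (simp add: T_dist_def abs_minus_commute conj_commute)
  assume "f \<in> quasi_convex_linear_growth" "g \<in> quasi_convex_linear_growth"
  then have fg: "linear_growth f" "linear_growth g"
    by (auto simp: quasi_convex_linear_growth_def)
  show "T_dist f g = 0 \<longleftrightarrow> f = g"
  proof
    assume "T_dist f g = 0"
    then show "f = g"
      using T_dist_upper[OF fg] by (intro T_inj) fastforce
  next
    assume "f = g"
    then have "T_dist f g \<le> 0"
      by (intro T_dist_least fg) auto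
    then show "T_dist f g = 0" using nonneg by simp
  qed
  assume "h \<in> quasi_convex_linear_growth"
  then have h: "linear_growth h" by (auto simp: quasi_convex_linear_growth_def)
  show "T_dist f h \<le> T_dist f g + T_dist g h"
  proof (rule T_dist_least[OF fg(1) h])
    fix z :: "real^'n^'m" assume z: "z \<in> ball 0 1"
    show "\<bar>T f z - T h z\<bar> \<le> T_dist f g + T_dist g h"
      using T_dist_upper[OF fg z] T_dist_upper[OF fg(2) h z] by linarith
  qed
qed

end

theory Submission
  imports Defs
begin

text \<open>
  Let \<open>N\<close> be the seminorm \<open>scalar_defect\<close>, whose kernel is the line of multiples of the
  identity; this line contains no rank-one direction, so quasi-convexity leaves freedom along it.
  For \<open>A \<subseteq> \<nat>\<close> let \<open>f\<^sub>A\<close> be the quasi-convex envelope of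
  \<open>g\<^sub>A z = C * N z + dist (z\<^sub>1\<^sub>1, {0} \<union> {2\<^sup>k. k \<notin> A})\<close>. Clearly \<open>f\<^sub>A (2\<^sup>k I) = 0\<close> for \<open>k \<notin> A\<close>, and for
  \<open>k \<in> A\<close> we show \<open>f\<^sub>A (2\<^sup>k I) \<ge> 2\<^sup>k / 8\<close>; hence distinct \<open>f\<^sub>A\<close> are uniformly separated.

  The lower bound is a weak-type Korn inequality: if \<open>\<integral> N (D\<phi>)\<close> is small for a test function \<open>\<phi>\<close> on
  the unit cube, then \<open>\<bar>\<partial>\<^sub>1\<phi>\<^sub>1\<bar> \<le> 1/4\<close> on at least half of the cube. It is obtained by truncation. Let
  \<open>G\<close> be the set where the maximal function of \<open>N (D\<phi>)\<close> is small (its complement has small measure by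
  Vitali's covering lemma), let \<open>\<rho>\<close> be the distance to \<open>G\<close>, and let \<open>v x\<close> be a radial average of \<open>\<phi>\<close>
  over the ball of radius \<open>\<rho> x\<close> around \<open>x\<close>. Then \<open>v = \<phi>\<close> on \<open>G\<close>, while the analogue of \<open>N (Dv)\<close> for
  difference quotients is small everywhere, because the derivative of the average with respect
  to the radius is controlled by \<open>N (D\<phi>)\<close> alone. The \<open>L\<^sup>2\<close> Korn inequality for \<open>v\<close> and Chebyshev's
  inequality conclude.
\<close>

section \<open>Integrals and continuously differentiable maps\<close>

lemma lborel_integral_affine:
  fixes f :: "'a::euclidean_space \<Rightarrow> 'b::{banach, second_countable_topology}"
  assumes "c \<noteq> 0" and [measurable]: "f \<in> borel_measurable borel"
  shows "integral\<^sup>L lborel f = \<bar>c\<bar> ^ DIM('a) *\<^sub>R (LINT x|lborel. f (t + c *\<^sub>R x))"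
  by (subst lborel_affine[OF assms(1), of t], subst integral_density, simp, simp, simp,
      subst integral_distr) simp_all

lemma lborel_integral_translation:
  fixes f :: "'a::euclidean_space \<Rightarrow> 'b::{banach, second_countable_topology}"
  assumes "f \<in> borel_measurable borel"
  shows "(LINT x|lborel. f (x + t)) = integral\<^sup>L lborel f"
  using lborel_integral_affine[OF _ assms, of 1 t] by (simp add: add.commute)

lemma set_integrable_continuous_bounded:
  fixes f :: "'a::euclidean_space \<Rightarrow> 'b::{banach, second_countable_topology}"
  assumes f: "continuous_on UNIV f" and S: "S \<in> sets borel" "bounded S"
  shows "set_integrable lborel S f"
proof -
  have "set_integrable lborel (closure S) f"
    unfolding set_integrable_def
    by (rule borel_integrable_compact)
       (use S continuous_on_subset[OF f] in \<open>auto simp: compact_closure\<close>)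
  then show ?thesis
    by (rule set_integrable_subset) (use S closure_subset in auto)
qed

section \<open>Maps of class C^1 and their Jacobian matrices\<close>

declare C_k.simps [simp del]

text \<open>The directional derivative along v is the Jacobian times v, so continuity for every
  fixed v amounts to continuity of the matrix field. From here on, smooth test functions enter only
  through class C^1.\<close>

lemma C_k_1_iff:
  fixes \<phi> :: "real^'n \<Rightarrow> real^'m"
  shows "C_k (Suc 0) \<phi> \<longleftrightarrow> (\<forall>x. \<phi> differentiable (at x)) \<and> continuous_on UNIV (jacobian_matrix \<phi>)"
proof -
  have "(\<forall>v. continuous_on UNIV (\<lambda>x. frechet_derivative \<phi> (at x) v)) \<longleftrightarrow>
     continuous_on UNIV (jacobian_matrix \<phi>)" if d: "\<forall>x. \<phi> differentiable (at x)"
  proof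
    assume c: "\<forall>v. continuous_on UNIV (\<lambda>x. frechet_derivative \<phi> (at x) v)"
    have "continuous_on UNIV (\<lambda>x. \<chi> i j. frechet_derivative \<phi> (at x) (axis j 1) $ i)"
      using c by (intro continuous_on_vec_lambda continuous_on_component) auto
    then show "continuous_on UNIV (jacobian_matrix \<phi>)"
      by (simp add: jacobian_matrix_def matrix_def)
  next
    assume c: "continuous_on UNIV (jacobian_matrix \<phi>)"
    show "\<forall>v. continuous_on UNIV (\<lambda>x. frechet_derivative \<phi> (at x) v)"
    proof
      fix v
      have "frechet_derivative \<phi> (at x) v = jacobian_matrix \<phi> x *v v" for x
        using d linear_frechet_derivative[of \<phi> "at x"]
        by (simp add: jacobian_matrix_def matrix_works)
      then show "continuous_on UNIV (\<lambda>x. frechet_derivative \<phi> (at x) v)"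
        unfolding matrix_vector_mult_def
        by (simp add: matrix_vector_mult_def)
           (intro continuous_on_vec_lambda continuous_intros continuous_on_component c)
    qed
  qed
  then show ?thesis by (auto simp: C_k.simps)
qed

lemma jacobian_matrix_has_derivative:
  fixes \<phi> :: "real^'n \<Rightarrow> real^'m"
  shows "\<phi> differentiable (at x) \<Longrightarrow> (\<phi> has_derivative ((*v) (jacobian_matrix \<phi> x))) (at x)"
  using jacobian_works[of \<phi> "at x"] by (simp add: jacobian_def jacobian_matrix_def)

lemma C_k_1_has_derivative:
  fixes \<phi> :: "real^'n \<Rightarrow> real^'m"
  assumes "C_k (Suc 0) \<phi>"
  shows "(\<phi> has_derivative ((*v) (jacobian_matrix \<phi> x))) (at x)"
  using assms by (simp add: C_k_1_iff jacobian_matrix_has_derivative)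

lemma jacobian_matrix_eqI:
  fixes \<phi> :: "real^'n \<Rightarrow> real^'m"
  assumes "(\<phi> has_derivative ((*v) A)) (at x)"
  shows "jacobian_matrix \<phi> x = A"
  using frechet_derivative_at[OF assms, symmetric] by (simp add: jacobian_matrix_def)

lemma C_k_1_I:
  fixes \<phi> :: "real^'n \<Rightarrow> real^'m"
  assumes d: "\<And>x. (\<phi> has_derivative ((*v) (J x))) (at x)" and J: "continuous_on UNIV J"
  shows "C_k (Suc 0) \<phi>" "jacobian_matrix \<phi> = J"
proof -
  show j: "jacobian_matrix \<phi> = J"
    using jacobian_matrix_eqI[OF d] by (rule ext)
  show "C_k (Suc 0) \<phi>"
    using d J by (auto simp: C_k_1_iff j differentiable_def)
qed

text \<open>The outer factor 1/c cancels the inner dilation, so the Jacobian is transported without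
  being rescaled. This moves test functions between the unit cube, its tiles and bounded open
  sets.\<close>

lemma C_k_1_affine:
  fixes \<phi> :: "real^'n \<Rightarrow> real^'m"
  assumes "C_k (Suc 0) \<phi>" "c \<noteq> 0"
  shows "C_k (Suc 0) (\<lambda>x. \<phi> (a + c *\<^sub>R x) /\<^sub>R c)"
    "jacobian_matrix (\<lambda>x. \<phi> (a + c *\<^sub>R x) /\<^sub>R c) = (\<lambda>x. jacobian_matrix \<phi> (a + c *\<^sub>R x))"
proof -
  have d: "((\<lambda>x. \<phi> (a + c *\<^sub>R x) /\<^sub>R c) has_derivative ((*v) (jacobian_matrix \<phi> (a + c *\<^sub>R x)))) (at x)" for x
  proof -
    have "((\<lambda>x. \<phi> (a + c *\<^sub>R x)) has_derivative (\<lambda>v. jacobian_matrix \<phi> (a + c *\<^sub>R x) *v (c *\<^sub>R v))) (at x)"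
      by (rule has_derivative_compose[OF _ C_k_1_has_derivative[OF assms(1)]])
         (auto intro!: derivative_eq_intros)
    from has_derivative_scaleR_right[OF this, of "inverse c"] show ?thesis
      using assms(2) by (simp add: matrix_vector_mult_scaleR)
  qed
  have c: "continuous_on UNIV (\<lambda>x. jacobian_matrix \<phi> (a + c *\<^sub>R x))"
    by (rule continuous_on_compose2[OF _ _ subset_UNIV])
       (use assms(1) in \<open>auto simp: C_k_1_iff intro!: continuous_intros\<close>)
  show "C_k (Suc 0) (\<lambda>x. \<phi> (a + c *\<^sub>R x) /\<^sub>R c)"
    "jacobian_matrix (\<lambda>x. \<phi> (a + c *\<^sub>R x) /\<^sub>R c) = (\<lambda>x. jacobian_matrix \<phi> (a + c *\<^sub>R x))"
    using C_k_1_I[OF d c] by auto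
qed

lemma C_k_1_add:
  fixes \<phi> \<psi> :: "real^'n \<Rightarrow> real^'m"
  assumes "C_k (Suc 0) \<phi>" "C_k (Suc 0) \<psi>"
  shows "C_k (Suc 0) (\<lambda>x. \<phi> x + \<psi> x)"
    "jacobian_matrix (\<lambda>x. \<phi> x + \<psi> x) = (\<lambda>x. jacobian_matrix \<phi> x + jacobian_matrix \<psi> x)"
proof -
  have d: "((\<lambda>x. \<phi> x + \<psi> x) has_derivative ((*v) (jacobian_matrix \<phi> x + jacobian_matrix \<psi> x))) (at x)" for x
    using has_derivative_add[OF C_k_1_has_derivative[OF assms(1)] C_k_1_has_derivative[OF assms(2)], of x]
    by (simp flip: matrix_vector_mult_add_rdistrib)
  have c: "continuous_on UNIV (\<lambda>x. jacobian_matrix \<phi> x + jacobian_matrix \<psi> x)"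
    using assms by (auto simp: C_k_1_iff intro!: continuous_intros)
  show "C_k (Suc 0) (\<lambda>x. \<phi> x + \<psi> x)"
    "jacobian_matrix (\<lambda>x. \<phi> x + \<psi> x) = (\<lambda>x. jacobian_matrix \<phi> x + jacobian_matrix \<psi> x)"
    using C_k_1_I[OF d c] by auto
qed

lemma zero_mv: "((*v) (0::real^'n^'m)) = (\<lambda>x. 0)"
  by (simp add: fun_eq_iff)

lemma C_k_1_zero:
  "C_k (Suc 0) (\<lambda>x::real^'n. 0::real^'m)" "jacobian_matrix (\<lambda>x::real^'n. 0::real^'m) = (\<lambda>x. 0)"
proof -
  have d: "((\<lambda>x::real^'n. 0::real^'m) has_derivative ((*v) 0)) (at x)" for x
    by (subst zero_mv) simp
  show "C_k (Suc 0) (\<lambda>x::real^'n. 0::real^'m)" "jacobian_matrix (\<lambda>x::real^'n. 0::real^'m) = (\<lambda>x. 0)"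
    using C_k_1_I[of _ "\<lambda>_. 0", OF d] by auto
qed

lemma C_k_1_sum:
  fixes \<phi> :: "'k \<Rightarrow> real^'n \<Rightarrow> real^'m"
  assumes "finite K" "\<And>k. k \<in> K \<Longrightarrow> C_k (Suc 0) (\<phi> k)"
  shows "C_k (Suc 0) (\<lambda>x. \<Sum>k\<in>K. \<phi> k x) \<and>
    jacobian_matrix (\<lambda>x. \<Sum>k\<in>K. \<phi> k x) = (\<lambda>x. \<Sum>k\<in>K. jacobian_matrix (\<phi> k) x)"
  using assms by (induction K rule: finite_induct) (simp_all add: C_k_1_zero C_k_1_add)

lemma jacobian_matrix_eq_0_if_open:
  fixes \<phi> :: "real^'n \<Rightarrow> real^'m"
  assumes "open S" "x \<in> S" "\<And>y. y \<in> S \<Longrightarrow> \<phi> y = 0"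
  shows "jacobian_matrix \<phi> x = 0"
proof (rule jacobian_matrix_eqI)
  have "((\<lambda>x. 0) has_derivative ((*v) (0::real^'n^'m))) (at x)"
    by (subst zero_mv) simp
  then show "(\<phi> has_derivative ((*v) 0)) (at x)"
    by (rule has_derivative_transform_within_open[OF _ assms(1,2)]) (simp add: assms(3))
qed

section \<open>The half-open unit cube and its test functions\<close>

definition unit_cube :: "(real^'n) set" where
  "unit_cube = {x. \<forall>i. 0 \<le> x $ i \<and> x $ i < 1}"

lemma unit_cube_subset_cbox: "unit_cube \<subseteq> cbox 0 1"
  by (auto simp: unit_cube_def mem_box_cart less_imp_le)

lemma bounded_unit_cube: "bounded unit_cube"
  using bounded_subset[OF bounded_cbox unit_cube_subset_cbox] .

lemma unit_cube_borel [measurable]: "unit_cube \<in> sets borel"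
proof -
  have "unit_cube = (\<Inter>i. {x::real^'n. 0 \<le> x $ i} \<inter> {x. x $ i < 1})"
    by (auto simp: unit_cube_def)
  also have "\<dots> \<in> sets borel"
    by (intro sets.countable_INT'' sets.Int borel_closed borel_open closed_halfspace_component_ge_cart
         open_halfspace_component_lt_cart) auto
  finally show ?thesis .
qed

lemma measure_unit_cube: "measure lborel (unit_cube :: (real^'n) set) = 1"
proof (rule antisym)
  have B: "(\<Prod>b\<in>(Basis::(real^'n) set). (1 - 0) \<bullet> b) = (1::real)"
    by (rule prod.neutral) (auto simp: Basis_vec_def inner_axis)
  have "measure lborel (unit_cube :: (real^'n) set) \<le> measure lborel (cbox 0 1 :: (real^'n) set)"
    by (rule measure_mono_fmeasurable[OF unit_cube_subset_cbox]) auto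
  also have "\<dots> = 1"
    using B by (subst measure_lborel_cbox) (auto simp: Basis_vec_def inner_axis)
  finally show "measure lborel (unit_cube :: (real^'n) set) \<le> 1" .
  have "1 = measure lborel (box 0 1 :: (real^'n) set)"
    using B by (subst measure_lborel_box) (auto simp: Basis_vec_def inner_axis)
  also have "\<dots> \<le> measure lborel (unit_cube :: (real^'n) set)"
  proof (rule measure_mono_fmeasurable)
    show "box 0 1 \<subseteq> (unit_cube :: (real^'n) set)"
      by (auto simp: unit_cube_def mem_box_cart less_imp_le)
    have "emeasure lborel (unit_cube :: (real^'n) set) \<le> emeasure lborel (cbox 0 1 :: (real^'n) set)"
      by (rule emeasure_mono[OF unit_cube_subset_cbox]) auto
    also have "\<dots> < \<infinity>" using fmeasurableD2[OF fmeasurable_cbox, of 0 "1::real^'n"] by (simp add: less_top)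
    finally show "unit_cube \<in> fmeasurable (lborel :: (real^'n) measure)"
      by (auto intro: fmeasurableI)
  qed auto
  finally show "1 \<le> measure lborel (unit_cube :: (real^'n) set)" .
qed

lemma set_integral_const_unit_cube: "(LINT x:unit_cube|lborel. c) = (c::real)"
proof -
  have "emeasure lborel (unit_cube :: (real^'k) set) < \<infinity>"
    by (rule emeasure_bounded_finite[OF bounded_unit_cube])
  then show "(LINT x:(unit_cube :: (real^'k) set)|lborel. c) = (c::real)"
    by (simp add: set_lebesgue_integral_def measure_unit_cube)
qed

text \<open>This class admits adding rescaled copies of its members on tiles, and it contains every
  element of \<open>smooth_compact_support D\<close> once \<open>D\<close> has been scaled into the
  cube.\<close>

definition cube_tests :: "(real^'n \<Rightarrow> real^'m) set" where
  "cube_tests = {\<phi>. C_k (Suc 0) \<phi> \<and> (\<forall>x. x \<notin> unit_cube \<longrightarrow> \<phi> x = 0)}"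

text \<open>A point off the half-open cube, even one on a face \<open>x $ i = 1\<close>, is a limit
  of points of the open exterior of the closed cube. There the map is locally zero, and continuity
  of the Jacobian carries its vanishing to the limit.\<close>

lemma jacobian_matrix_eq_0_off_cube:
  fixes \<phi> :: "real^'n \<Rightarrow> real^'m"
  assumes \<phi>: "\<phi> \<in> cube_tests" and x: "x \<notin> unit_cube"
  shows "jacobian_matrix \<phi> x = 0"
proof -
  define S where "S = (\<Union>i. {y::real^'n. y $ i < 0} \<union> {y. y $ i > 1})"
  have S: "open S" unfolding S_def
    by (intro open_UN open_Un ballI open_halfspace_component_lt_cart open_halfspace_component_gt_cart)
  have "closed {y. jacobian_matrix \<phi> y = 0}"
    using \<phi> by (intro closed_Collect_eq) (auto simp: cube_tests_def C_k_1_iff)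
  moreover have "S \<subseteq> {y. jacobian_matrix \<phi> y = 0}"
  proof
    have "y \<notin> unit_cube" if "y \<in> S" for y
      using that unfolding S_def unit_cube_def by (auto simp: not_le) (metis less_asym not_less)
    then show "y \<in> {y. jacobian_matrix \<phi> y = 0}" if "y \<in> S" for y
      using jacobian_matrix_eq_0_if_open[OF S that] \<phi> by (auto simp: cube_tests_def)
  qed
  ultimately have "closure S \<subseteq> {y. jacobian_matrix \<phi> y = 0}" by (rule closure_minimal[rotated])
  moreover have "x \<in> closure S"
  proof -
    obtain i where i: "x $ i < 0 \<or> 1 \<le> x $ i"
      using x by (auto simp: unit_cube_def not_less not_le)
    show ?thesis
    proof (cases "x $ i < 0")
      case True
      then have "x \<in> S" by (auto simp: S_def)
      then show ?thesis using closure_subset by auto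
    next
      case False
      show ?thesis unfolding closure_approachable
      proof (intro allI impI)
        fix e :: real assume e: "e > 0"
        have "x + (e/2) *\<^sub>R axis i 1 \<in> S"
          using False i e by (auto simp: S_def intro!: exI[of _ i])
        moreover have "dist (x + (e/2) *\<^sub>R axis i 1) x < e"
          using e by (simp add: dist_norm)
        ultimately show "\<exists>y\<in>S. dist y x < e" by blast
      qed
    qed
  qed
  ultimately show ?thesis by auto
qed

section \<open>The quasi-convex envelope\<close>

text \<open>Dacorogna's formula for the quasi-convex envelope, with a cube of measure 1 as reference
  domain.\<close>

definition envelope :: "(real^'n^'m \<Rightarrow> real) \<Rightarrow> real^'n^'m \<Rightarrow> real" where
  "envelope g z = (INF \<phi>\<in>cube_tests. LINT x:unit_cube|lborel. g (z + jacobian_matrix \<phi> x))"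

lemma zero_in_cube_tests: "(\<lambda>x. 0) \<in> cube_tests"
  by (simp add: cube_tests_def C_k_1_zero)

text \<open>Nonnegativity bounds the infimum in \<open>envelope\<close> from below. The Lipschitz
  bound makes the integrands continuous and is inherited by the envelope, which is then an instance
  of the same locale.\<close>

locale lipschitz_integrand =
  fixes g :: "real^'n^'m \<Rightarrow> real" and L :: real
  assumes lipschitz: "\<bar>g z - g w\<bar> \<le> L * norm (z - w)" and nonneg: "0 \<le> g z"
begin

lemma continuous_g: "continuous_on UNIV g"
proof -
  have "\<bar>L\<bar>-lipschitz_on UNIV g"
    by (intro lipschitz_onI)
       (auto simp: dist_norm intro: order_trans[OF lipschitz mult_right_mono[OF abs_ge_self]])
  then show ?thesis by (rule lipschitz_on_continuous_on)
qed

lemma continuous_integrand: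
  assumes "continuous_on UNIV J"
  shows "continuous_on UNIV (\<lambda>x. g (z + J x))"
  by (rule continuous_on_compose2[OF continuous_g _ subset_UNIV]) (intro continuous_intros assms)

lemma integrand_integrable:
  fixes \<phi> :: "real^'n \<Rightarrow> real^'m"
  assumes "C_k (Suc 0) \<phi>" "S \<in> sets borel" "bounded S"
  shows "set_integrable lborel S (\<lambda>x. g (z + jacobian_matrix \<phi> x))"
  using assms by (intro set_integrable_continuous_bounded continuous_integrand) (auto simp: C_k_1_iff)

lemma bdd_below_integrals:
  "bdd_below ((\<lambda>\<phi>. LINT x:unit_cube|lborel. g (z + jacobian_matrix \<phi> x)) ` cube_tests)"
  by (rule bdd_belowI2[of _ 0]) (auto simp: set_lebesgue_integral_def nonneg)

lemma envelope_le:
  "\<phi> \<in> cube_tests \<Longrightarrow> envelope g z \<le> (LINT x:unit_cube|lborel. g (z + jacobian_matrix \<phi> x))"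
  unfolding envelope_def by (rule cINF_lower[OF bdd_below_integrals])

lemma envelope_ge:
  assumes "\<And>\<phi>. \<phi> \<in> cube_tests \<Longrightarrow> c \<le> (LINT x:unit_cube|lborel. g (z + jacobian_matrix \<phi> x))"
  shows "c \<le> envelope g z"
  unfolding envelope_def using zero_in_cube_tests assms by (intro cINF_greatest) auto

lemma envelope_nonneg: "0 \<le> envelope g z"
  by (rule envelope_ge) (auto simp: set_lebesgue_integral_def nonneg)

lemma envelope_approx:
  assumes "e > 0"
  obtains \<phi> where "\<phi> \<in> cube_tests" "(LINT x:unit_cube|lborel. g (z + jacobian_matrix \<phi> x)) < envelope g z + e"
proof -
  have "\<exists>\<phi>\<in>cube_tests. (LINT x:unit_cube|lborel. g (z + jacobian_matrix \<phi> x)) < envelope g z + e"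
    using zero_in_cube_tests assms unfolding envelope_def
    by (subst cINF_less_iff[symmetric]) (auto intro: bdd_below_integrals)
  then show ?thesis using that by blast
qed

lemma envelope_le_self: "envelope g z \<le> g z"
  using envelope_le[OF zero_in_cube_tests, of z]
  by (simp add: C_k_1_zero set_integral_const_unit_cube)

text \<open>For each fixed test function the integral is Lipschitz in z with constant
  \<open>L\<close>, because the cube has measure 1; the infimum keeps this bound.\<close>

lemma envelope_lipschitz: "\<bar>envelope g z - envelope g w\<bar> \<le> L * norm (z - w)"
proof -
  have "envelope g z - L * norm (z - w) \<le> envelope g w" for z w
  proof (rule envelope_ge)
    fix \<phi> :: "real^'n \<Rightarrow> real^'m" assume \<phi>: "\<phi> \<in> cube_tests"
    then have C: "C_k (Suc 0) \<phi>" by (simp add: cube_tests_def)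
    note int = integrand_integrable[OF C unit_cube_borel bounded_unit_cube]
    have c: "set_integrable lborel unit_cube (\<lambda>x::real^'n. L * norm (z - w))"
      by (intro set_integrable_continuous_bounded bounded_unit_cube unit_cube_borel continuous_intros)
    have "envelope g z \<le> (LINT x:unit_cube|lborel. g (z + jacobian_matrix \<phi> x))"
      by (rule envelope_le[OF \<phi>])
    also have "\<dots> \<le> (LINT x:unit_cube|lborel. g (w + jacobian_matrix \<phi> x) + L * norm (z - w))"
    proof (rule set_integral_mono[OF int set_integral_add(1)[OF int c]])
      fix x show "g (z + jacobian_matrix \<phi> x) \<le> g (w + jacobian_matrix \<phi> x) + L * norm (z - w)"
        using lipschitz[of "z + jacobian_matrix \<phi> x" "w + jacobian_matrix \<phi> x"] by simp
    qed
    also have "\<dots> = (LINT x:unit_cube|lborel. g (w + jacobian_matrix \<phi> x)) + L * norm (z - w)"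
      by (subst set_integral_add(2)[OF int c]) (simp add: set_integral_const_unit_cube)
    finally show "envelope g z - L * norm (z - w) \<le> (LINT x:unit_cube|lborel. g (w + jacobian_matrix \<phi> x))"
      by simp
  qed
  from this[of z w] this[of w z] show ?thesis by (simp add: norm_minus_commute abs_le_iff)
qed

lemma envelope_integrand: "lipschitz_integrand (envelope g) L"
  by standard (rule envelope_lipschitz envelope_nonneg)+

text \<open>Subdividing the cube into small cubes on which the Jacobian of \<open>\<psi>\<close> is almost constant,
  and adding to \<open>\<psi>\<close> rescaled almost optimal test functions on each of them, gives a competitor
  for \<^term>\<open>envelope g z\<close>.\<close>

lemma envelope_jensen_cube:
  assumes \<psi>: "\<psi> \<in> cube_tests"
  shows "envelope g z \<le> (LINT x:unit_cube|lborel. envelope g (z + jacobian_matrix \<psi> x))"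
proof (rule field_le_epsilon)
  interpret E: lipschitz_integrand "envelope g" L by (rule envelope_integrand)
  fix e' :: real assume "e' > 0"
  \<comment> \<open>Three errors are budgeted: \<open>e\<close> for almost optimal test functions,
    and \<open>\<bar>L\<bar> * e\<close> twice, for freezing the Jacobian of \<open>\<psi>\<close>
    inside \<open>g\<close> and inside \<open>envelope g\<close>.\<close>
  define e where "e = e' / (1 + 2 * \<bar>L\<bar>)"
  have e: "e > 0" using \<open>e' > 0\<close> by (simp add: e_def add_pos_nonneg)
  have "e * (1 + 2 * \<bar>L\<bar>) = e'"
    by (simp add: e_def)
  then have e'_eq: "e + 2 * (\<bar>L\<bar> * e) = e'" by (simp add: algebra_simps)
  have C\<psi>: "C_k (Suc 0) \<psi>" and cont: "continuous_on UNIV (jacobian_matrix \<psi>)"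
    using \<psi> by (auto simp: cube_tests_def C_k_1_iff)
  have "uniformly_continuous_on (cbox 0 1) (jacobian_matrix \<psi>)"
    by (rule compact_uniformly_continuous[OF continuous_on_subset[OF cont]]) auto
  then obtain d where d: "d > 0"
      and d_close: "\<And>x y. x \<in> unit_cube \<Longrightarrow> y \<in> unit_cube \<Longrightarrow> dist x y < d \<Longrightarrow>
        dist (jacobian_matrix \<psi> x) (jacobian_matrix \<psi> y) < e"
    using e unit_cube_subset_cbox unfolding uniformly_continuous_on_def by (metis subsetD)
  \<comment> \<open>By the l1 bound, a point of a tile of side 1/N lies within
    \<open>CARD('n) / N\<close> of the corner of the tile, hence within \<open>d\<close>.\<close>
  obtain N :: nat where N: "real CARD('n) / d < real N" using reals_Archimedean2 by blast
  have N0: "real N > 0" using N d by (meson divide_nonneg_pos le_less_trans of_nat_0_le_iff)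
  define K where "K = {k :: 'n \<Rightarrow> nat. \<forall>i. k i < N}"
  have "K = (UNIV :: 'n set) \<rightarrow>\<^sub>E {..<N}" by (auto simp: K_def PiE_def extensional_def)
  then have finK: "finite K" by (simp add: finite_PiE)
  \<comment> \<open>\<open>q k\<close> is the lower corner of tile \<open>k\<close>, and the affine
    map in \<open>tile\<close> carries the tile onto the cube. Since the cube is half-open, the
    tiles with index in \<open>K\<close> partition it exactly, without null sets to discard.\<close>
  define q where "q k = (\<chi> i. real (k i) / real N)" for k :: "'n \<Rightarrow> nat"
  define tile where "tile k = {x. - (real N *\<^sub>R q k) + real N *\<^sub>R x \<in> unit_cube}" for k
  have tile_iff: "x \<in> tile k \<longleftrightarrow> (\<forall>i. real (k i) \<le> real N * x $ i \<and> real N * x $ i < real (k i) + 1)" for x k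
    using N0 by (auto simp: tile_def unit_cube_def q_def algebra_simps)
  have tile_cube: "unit_cube = (\<Union>k\<in>K. tile k)"
  proof (intro set_eqI iffI)
    fix x :: "real^'n" assume x: "x \<in> unit_cube"
    define k where "k i = nat \<lfloor>real N * x $ i\<rfloor>" for i
    have k: "real (k i) \<le> real N * x $ i \<and> real N * x $ i < real (k i) + 1" for i
    proof -
      have "0 \<le> real N * x $ i" using x by (simp add: unit_cube_def)
      then show ?thesis unfolding k_def by linarith
    qed
    moreover have "k i < N" for i
    proof -
      have "real N * x $ i < real N * 1"
        using x N0 by (intro mult_strict_left_mono) (auto simp: unit_cube_def)
      then show ?thesis using k[of i] by linarith
    qed
    ultimately show "x \<in> (\<Union>k\<in>K. tile k)" by (auto simp: K_def tile_iff)
  next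
    fix x assume "x \<in> (\<Union>k\<in>K. tile k)"
    then obtain k where k: "k \<in> K" "x \<in> tile k" by auto
    have "0 \<le> x $ i \<and> x $ i < 1" for i
    proof -
      have 1: "real (k i) \<le> real N * x $ i" "real N * x $ i < real (k i) + 1" "k i < N"
        using k by (auto simp: K_def tile_iff)
      then have "0 \<le> real N * x $ i" "real N * x $ i < real N * 1" by linarith+
      then show ?thesis using N0 by (simp add: zero_le_mult_iff)
    qed
    then show "x \<in> unit_cube" by (simp add: unit_cube_def)
  qed
  have tile_unique: "k = l" if "x \<in> tile k" "x \<in> tile l" for x k l
  proof
    fix i have "real (k i) < real (l i) + 1" "real (l i) < real (k i) + 1"
      using that unfolding tile_iff by (meson le_less_trans)+
    then show "k i = l i" by linarith
  qed
  have disj: "disjoint_family_on tile K" using tile_unique by (auto simp: disjoint_family_on_def)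
  have tile_meas: "tile k \<in> sets borel" for k
  proof -
    have "(\<lambda>x::real^'n. - (real N *\<^sub>R q k) + real N *\<^sub>R x) -` unit_cube \<inter> space borel \<in> sets borel"
      by (rule measurable_sets[OF _ unit_cube_borel]) auto
    then show ?thesis by (simp add: tile_def vimage_def)
  qed
  have tile_bdd: "bounded (tile k)" if "k \<in> K" for k
    using that tile_cube by (intro bounded_subset[OF bounded_unit_cube]) auto
  have q_cube: "q k \<in> unit_cube" if "k \<in> K" for k
    using that N0 by (auto simp: K_def unit_cube_def q_def)
  have q_close: "norm (jacobian_matrix \<psi> x - jacobian_matrix \<psi> (q k)) < e" if "k \<in> K" "x \<in> tile k" for k x
  proof -
    have "norm (x - q k) \<le> (\<Sum>i\<in>UNIV. \<bar>(x - q k) $ i\<bar>)" by (rule norm_le_l1_cart)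
    also have "\<dots> \<le> (\<Sum>i\<in>(UNIV::'n set). 1 / real N)"
    proof (rule sum_mono)
      fix i
      have "real (k i) \<le> real N * x $ i" "real N * x $ i < real (k i) + 1" using that by (auto simp: tile_iff)
      then have "\<bar>real N * x $ i - real (k i)\<bar> \<le> 1" by linarith
      moreover have "(x - q k) $ i = (real N * x $ i - real (k i)) / real N"
        using N0 by (simp add: q_def field_simps)
      ultimately show "\<bar>(x - q k) $ i\<bar> \<le> 1 / real N"
        using N0 by (simp add: abs_divide divide_right_mono)
    qed
    also have "\<dots> = real CARD('n) / real N" by simp
    also have "\<dots> < d" using N d N0 by (simp add: field_simps)
    finally show ?thesis
      using d_close[of x "q k"] that q_cube tile_cube by (auto simp: dist_norm)
  qed
  have tile_scale: "(LINT x:tile k|lborel. F (- (real N *\<^sub>R q k) + real N *\<^sub>R x)) =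
      (1 / real N ^ CARD('n)) * (LINT x:unit_cube|lborel. F x)"
    if F: "F \<in> borel_measurable borel" for F :: "real^'n \<Rightarrow> real" and k
  proof -
    have "(LINT x:unit_cube|lborel. F x) = real N ^ CARD('n) *
       (LINT x|lborel. indicator unit_cube (- (real N *\<^sub>R q k) + real N *\<^sub>R x) * F (- (real N *\<^sub>R q k) + real N *\<^sub>R x))"
    proof -
      have "(\<lambda>x. indicator unit_cube x * F x) \<in> borel_measurable borel"
        using F by (intro borel_measurable_times borel_measurable_indicator unit_cube_borel)
      from lborel_integral_affine[OF _ this, of "real N" "- (real N *\<^sub>R q k)"] show ?thesis
        using N0 by (simp add: set_lebesgue_integral_def)
    qed
    also have "(LINT x|lborel. indicator unit_cube (- (real N *\<^sub>R q k) + real N *\<^sub>R x) * F (- (real N *\<^sub>R q k) + real N *\<^sub>R x))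
      = (LINT x:tile k|lborel. F (- (real N *\<^sub>R q k) + real N *\<^sub>R x))"
      unfolding set_lebesgue_integral_def
      by (intro Bochner_Integration.integral_cong) (auto simp: tile_def indicator_def)
    finally show ?thesis using N0 by simp
  qed
  have "\<forall>k. \<exists>\<theta>. \<theta> \<in> cube_tests \<and>
      (LINT x:unit_cube|lborel. g (z + jacobian_matrix \<psi> (q k) + jacobian_matrix \<theta> x))
        < envelope g (z + jacobian_matrix \<psi> (q k)) + e"
    using envelope_approx[OF e] by metis
  then obtain \<theta> where \<theta>: "\<And>k. \<theta> k \<in> cube_tests"
    and \<theta>_opt: "\<And>k. (LINT x:unit_cube|lborel. g (z + jacobian_matrix \<psi> (q k) + jacobian_matrix (\<theta> k) x))
        < envelope g (z + jacobian_matrix \<psi> (q k)) + e"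
    by metis
  have C\<theta>: "C_k (Suc 0) (\<theta> k)" for k using \<theta>[of k] by (simp add: cube_tests_def)
  define \<eta> where "\<eta> k x = \<theta> k (- (real N *\<^sub>R q k) + real N *\<^sub>R x) /\<^sub>R real N" for k x
  have C\<eta>: "C_k (Suc 0) (\<eta> k)"
    "jacobian_matrix (\<eta> k) = (\<lambda>x. jacobian_matrix (\<theta> k) (- (real N *\<^sub>R q k) + real N *\<^sub>R x))" for k
    using C_k_1_affine[OF C\<theta>, of "real N" k "- (real N *\<^sub>R q k)"] N0 by (auto simp: \<eta>_def[abs_def])
  have \<eta>_off: "\<eta> k x = 0" "jacobian_matrix (\<eta> k) x = 0" if "x \<notin> tile k" for k x
    using that \<theta>[of k] jacobian_matrix_eq_0_off_cube[OF \<theta>[of k]] unfolding C\<eta>(2)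
    by (simp_all add: \<eta>_def tile_def cube_tests_def)
  define \<Phi> where "\<Phi> x = \<psi> x + (\<Sum>k\<in>K. \<eta> k x)" for x
  have C\<Phi>: "C_k (Suc 0) \<Phi>"
    "jacobian_matrix \<Phi> = (\<lambda>x. jacobian_matrix \<psi> x + (\<Sum>k\<in>K. jacobian_matrix (\<eta> k) x))"
  proof -
    have "C_k (Suc 0) (\<lambda>x. \<Sum>k\<in>K. \<eta> k x)"
      "jacobian_matrix (\<lambda>x. \<Sum>k\<in>K. \<eta> k x) = (\<lambda>x. \<Sum>k\<in>K. jacobian_matrix (\<eta> k) x)"
      using C_k_1_sum[OF finK C\<eta>(1)] by auto
    note * = C_k_1_add[OF C\<psi> this(1), folded \<Phi>_def[abs_def]] this(2)
    show "C_k (Suc 0) \<Phi>" by (rule *)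
    show "jacobian_matrix \<Phi> = (\<lambda>x. jacobian_matrix \<psi> x + (\<Sum>k\<in>K. jacobian_matrix (\<eta> k) x))"
      unfolding *(2) *(3) ..
  qed
  have J\<Phi>: "jacobian_matrix \<Phi> x = jacobian_matrix \<psi> x + jacobian_matrix (\<eta> k) x"
    if "k \<in> K" "x \<in> tile k" for k x
  proof -
    have "(\<Sum>l\<in>K. jacobian_matrix (\<eta> l) x) = (\<Sum>l\<in>{k}. jacobian_matrix (\<eta> l) x)"
    proof (intro sum.mono_neutral_right finK ballI)
      fix l assume "l \<in> K - {k}"
      then have "x \<notin> tile l" using tile_unique[OF that(2), of l] by blast
      then show "jacobian_matrix (\<eta> l) x = 0" by (rule \<eta>_off)
    qed (use that in auto)
    then show ?thesis by (simp add: C\<Phi>)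
  qed
  have \<Phi>: "\<Phi> \<in> cube_tests"
    unfolding cube_tests_def
  proof (intro CollectI conjI allI impI)
    fix x :: "real^'n" assume x: "x \<notin> unit_cube"
    then have "(\<Sum>k\<in>K. \<eta> k x) = 0" using tile_cube by (intro sum.neutral ballI \<eta>_off(1)) auto
    then show "\<Phi> x = 0" using x \<psi> by (simp add: \<Phi>_def cube_tests_def)
  qed (rule C\<Phi>)
  have split: "(LINT x:unit_cube|lborel. f x) = (\<Sum>k\<in>K. LINT x:tile k|lborel. f x)"
    if "continuous_on UNIV f" for f :: "real^'n \<Rightarrow> real"
    unfolding tile_cube
    by (rule set_integral_finite_Union[OF finK disj])
       (use that tile_meas tile_bdd in \<open>auto intro: set_integrable_continuous_bounded\<close>)
  have contJ: "continuous_on UNIV (jacobian_matrix \<Phi>)" "continuous_on UNIV (jacobian_matrix (\<theta> k))" for k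
    using C\<Phi> C\<theta> by (auto simp: C_k_1_iff)
  have tile_le: "(LINT x:tile k|lborel. g (z + jacobian_matrix \<Phi> x)) \<le>
      (LINT x:tile k|lborel. envelope g (z + jacobian_matrix \<psi> x) + e')" if k: "k \<in> K" for k
  proof -
    define A where "A = jacobian_matrix \<psi> (q k)"
    \<comment> \<open>\<open>H\<close> is the integrand with the Jacobian of \<open>\<psi>\<close>
      frozen at the corner, plus the cost of freezing. It is written in the coordinates of the unit
      cube, where the choice of \<open>\<theta> k\<close> applies.\<close>
    define H where "H y = g (z + A + jacobian_matrix (\<theta> k) y) + \<bar>L\<bar> * e" for y
    have contH: "continuous_on UNIV H"
      unfolding H_def by (intro continuous_intros continuous_integrand contJ)
    have H_meas: "H \<in> borel_measurable borel"
      using contH by (rule borel_measurable_continuous_onI)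
    have contH': "continuous_on UNIV (\<lambda>x. H (- (real N *\<^sub>R q k) + real N *\<^sub>R x))"
      by (rule continuous_on_compose2[OF contH _ subset_UNIV]) (intro continuous_intros)
    note int = set_integrable_continuous_bounded[OF _ tile_meas tile_bdd[OF k]]
    have lip: "\<bar>g (z + jacobian_matrix \<psi> x + B) - g (z + A + B)\<bar> \<le> \<bar>L\<bar> * e"
      "\<bar>envelope g (z + jacobian_matrix \<psi> x) - envelope g (z + A)\<bar> \<le> \<bar>L\<bar> * e" if "x \<in> tile k" for x B
    proof -
      have "norm (jacobian_matrix \<psi> x - A) \<le> e" using q_close[OF k that] by (simp add: A_def)
      then have *: "L * norm (jacobian_matrix \<psi> x - A) \<le> \<bar>L\<bar> * e"
        by (meson abs_ge_self mult_mono abs_ge_zero norm_ge_zero)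
      show "\<bar>g (z + jacobian_matrix \<psi> x + B) - g (z + A + B)\<bar> \<le> \<bar>L\<bar> * e"
        using lipschitz[of "z + jacobian_matrix \<psi> x + B" "z + A + B"] * by simp
      show "\<bar>envelope g (z + jacobian_matrix \<psi> x) - envelope g (z + A)\<bar> \<le> \<bar>L\<bar> * e"
        using envelope_lipschitz[of "z + jacobian_matrix \<psi> x" "z + A"] * by simp
    qed
    have "(LINT x:tile k|lborel. g (z + jacobian_matrix \<Phi> x)) \<le>
        (LINT x:tile k|lborel. H (- (real N *\<^sub>R q k) + real N *\<^sub>R x))"
    proof (rule set_integral_mono[OF int int])
      fix x assume x: "x \<in> tile k"
      show "g (z + jacobian_matrix \<Phi> x) \<le> H (- (real N *\<^sub>R q k) + real N *\<^sub>R x)"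
        using lip(1)[OF x, of "jacobian_matrix (\<eta> k) x"]
        by (simp add: J\<Phi>[OF k x] H_def C\<eta>(2) add.assoc)
    qed (intro contH' continuous_integrand contJ)+
    also have "\<dots> = (1 / real N ^ CARD('n)) * (LINT x:unit_cube|lborel. H x)"
      by (rule tile_scale[OF H_meas])
    also have "\<dots> \<le> (1 / real N ^ CARD('n)) * (LINT x:(unit_cube::(real^'n) set)|lborel. envelope g (z + A) + e + \<bar>L\<bar> * e)"
    proof (rule mult_left_mono)
      have "(LINT x:unit_cube|lborel. H x) =
        (LINT x:unit_cube|lborel. g (z + A + jacobian_matrix (\<theta> k) x)) + \<bar>L\<bar> * e"
        unfolding H_def
        by (subst set_integral_add(2)) (auto intro!: continuous_integrand contJ bounded_unit_cube
           set_integrable_continuous_bounded simp: set_integral_const_unit_cube)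
      also have "\<dots> \<le> envelope g (z + A) + e + \<bar>L\<bar> * e" using \<theta>_opt[of k] by (simp add: A_def)
      finally show "(LINT x:unit_cube|lborel. H x) \<le> (LINT x:(unit_cube::(real^'n) set)|lborel. envelope g (z + A) + e + \<bar>L\<bar> * e)"
        by (simp add: set_integral_const_unit_cube)
    qed simp
    also have "\<dots> = (LINT x:tile k|lborel. envelope g (z + A) + e + \<bar>L\<bar> * e)"
      by (rule tile_scale[symmetric]) simp
    also have "\<dots> \<le> (LINT x:tile k|lborel. envelope g (z + jacobian_matrix \<psi> x) + e')"
    proof (rule set_integral_mono[OF int int])
      fix x assume x: "x \<in> tile k"
      show "envelope g (z + A) + e + \<bar>L\<bar> * e \<le> envelope g (z + jacobian_matrix \<psi> x) + e'"
        using lip(2)[OF x] e'_eq by linarith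
    qed (intro continuous_intros E.continuous_integrand cont)+
    finally show ?thesis .
  qed
  have "envelope g z \<le> (LINT x:unit_cube|lborel. g (z + jacobian_matrix \<Phi> x))"
    by (rule envelope_le[OF \<Phi>])
  also have "\<dots> = (\<Sum>k\<in>K. LINT x:tile k|lborel. g (z + jacobian_matrix \<Phi> x))"
    by (rule split) (intro continuous_integrand contJ)
  also have "\<dots> \<le> (\<Sum>k\<in>K. LINT x:tile k|lborel. envelope g (z + jacobian_matrix \<psi> x) + e')"
    by (rule sum_mono[OF tile_le])
  also have "\<dots> = (LINT x:unit_cube|lborel. envelope g (z + jacobian_matrix \<psi> x) + e')"
    by (rule split[symmetric]) (intro continuous_intros E.continuous_integrand cont)
  also have "\<dots> = (LINT x:unit_cube|lborel. envelope g (z + jacobian_matrix \<psi> x)) + e'"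
    by (subst set_integral_add(2)) (auto intro!: E.continuous_integrand cont bounded_unit_cube
           set_integrable_continuous_bounded simp: set_integral_const_unit_cube)
  finally show "envelope g z \<le> (LINT x:unit_cube|lborel. envelope g (z + jacobian_matrix \<psi> x)) + e'" .
qed

text \<open>An affine change of variables turns a test function on \<open>D\<close> into one on the
  cube, where \<open>envelope_jensen_cube\<close> applies. Subtracting \<open>envelope g z\<close>
  makes the integrand vanish off \<open>D\<close>, so the integrals over the two domains differ only
  by a positive scale factor.\<close>

theorem quasi_convex_envelope: "quasi_convex (envelope g)"
  unfolding quasi_convex_def
proof (intro conjI allI ballI impI)
  interpret E: lipschitz_integrand "envelope g" L by (rule envelope_integrand)
  show "continuous_on UNIV (envelope g)" by (rule E.continuous_g)
  fix z :: "real^'n^'m" and D :: "(real^'n) set" and \<phi> :: "real^'n \<Rightarrow> real^'m"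
  assume "\<phi> \<in> smooth_compact_support D" and D: "open D" "bounded D"
  then have C\<phi>: "C_k (Suc 0) \<phi>" and supp: "closure {x. \<phi> x \<noteq> 0} \<subseteq> D"
    by (auto simp: smooth_compact_support_def)
  define F where "F x = envelope g (z + jacobian_matrix \<phi> x) - envelope g z" for x
  have contF: "continuous_on UNIV F"
    unfolding F_def using C\<phi> by (intro continuous_intros E.continuous_integrand) (simp add: C_k_1_iff)
  have F_meas: "F \<in> borel_measurable borel" using contF by (rule borel_measurable_continuous_onI)
  have F_off: "F x = 0" if "x \<notin> D" for x
  proof -
    have "jacobian_matrix \<phi> x = 0"
    proof (rule jacobian_matrix_eq_0_if_open[of "- closure {x. \<phi> x \<noteq> 0}"])
      show "\<phi> y = 0" if "y \<in> - closure {x. \<phi> x \<noteq> 0}" for y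
        using that closure_subset[of "{x. \<phi> x \<noteq> 0}"] by blast
    qed (use that supp in auto)
    then show ?thesis by (simp add: F_def)
  qed
  obtain b where b: "b > 0" "\<And>x. x \<in> D \<Longrightarrow> norm x < b"
    using D(2) by (meson bounded_pos_less)
  \<comment> \<open>The map \<open>y \<mapsto> a + s *\<^sub>R y\<close> sends the unit cube onto
    [-b, b)^n, which contains \<open>D\<close>.\<close>
  define a :: "real^'n" where "a = (\<chi> i. - b)"
  define s where "s = 2 * b"
  have s: "s > 0" "s \<noteq> 0" using b by (auto simp: s_def)
  have in_cube: "y \<in> unit_cube" if "a + s *\<^sub>R y \<in> D" for y
    unfolding unit_cube_def
  proof (intro CollectI allI)
    fix i
    have "\<bar>(a + s *\<^sub>R y) $ i\<bar> < b"
      using component_le_norm_cart[of "a + s *\<^sub>R y" i] b(2)[OF that] by linarith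
    then have "0 \<le> s * y $ i" "s * y $ i < s * 1" by (auto simp: a_def s_def)
    then show "0 \<le> y $ i \<and> y $ i < 1" using s by (simp add: zero_le_mult_iff)
  qed
  define \<psi> where "\<psi> y = \<phi> (a + s *\<^sub>R y) /\<^sub>R s" for y
  have J\<psi>: "jacobian_matrix \<psi> y = jacobian_matrix \<phi> (a + s *\<^sub>R y)" for y
    using C_k_1_affine(2)[OF C\<phi> s(2), of a] by (simp add: \<psi>_def[abs_def])
  have \<psi>: "\<psi> \<in> cube_tests"
    unfolding cube_tests_def
  proof (intro CollectI conjI allI impI)
    show "C_k (Suc 0) \<psi>" using C_k_1_affine(1)[OF C\<phi> s(2), of a] by (simp add: \<psi>_def[abs_def])
    fix y :: "real^'n" assume "y \<notin> unit_cube"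
    then have "a + s *\<^sub>R y \<notin> D" using in_cube by blast
    then have "\<phi> (a + s *\<^sub>R y) = 0" using supp closure_subset[of "{x. \<phi> x \<noteq> 0}"] by blast
    then show "\<psi> y = 0" by (simp add: \<psi>_def)
  qed
  have C\<psi>: "C_k (Suc 0) \<psi>" using \<psi> by (simp add: cube_tests_def)
  note bu = unit_cube_borel bounded_unit_cube
  have "0 \<le> (LINT y:unit_cube|lborel. envelope g (z + jacobian_matrix \<psi> y)) - envelope g z"
    using envelope_jensen_cube[OF \<psi>, of z] by simp
  also have "\<dots> = (LINT y:unit_cube|lborel. envelope g (z + jacobian_matrix \<psi> y) - envelope g z)"
    by (subst set_integral_diff(2)[OF E.integrand_integrable[OF C\<psi> bu]
          set_integrable_continuous_bounded[OF continuous_on_const bu]])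
       (simp add: set_integral_const_unit_cube)
  also have "\<dots> = (LINT y|lborel. F (a + s *\<^sub>R y))"
    unfolding set_lebesgue_integral_def F_def[symmetric] J\<psi>
    by (intro Bochner_Integration.integral_cong) (use in_cube F_off in \<open>auto simp: indicator_def\<close>)
  finally have "0 \<le> s ^ CARD('n) * (LINT y|lborel. F (a + s *\<^sub>R y))" using s by simp
  also have "\<dots> = integral\<^sup>L lborel F"
    using lborel_integral_affine[OF s(2) F_meas, of a] s by simp
  also have "\<dots> = (LINT x:D|lborel. F x)"
    unfolding set_lebesgue_integral_def
    by (intro Bochner_Integration.integral_cong) (use F_off in \<open>auto simp: indicator_def\<close>)
  also have "\<dots> = (LINT x:D|lborel. envelope g (z + jacobian_matrix \<phi> x)) - (LINT x:D|lborel. envelope g z)"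
    unfolding F_def using D
    by (intro set_integral_diff(2) E.integrand_integrable[OF C\<phi>] set_integrable_continuous_bounded) auto
  also have "(LINT x:D|lborel. envelope g z) = measure lborel D * envelope g z"
    using emeasure_bounded_finite[OF D(2)] D by (simp add: set_integral_const)
  finally show "measure lborel D * envelope g z \<le> (LINT x:D|lborel. envelope g (z + jacobian_matrix \<phi> x))" by simp
qed

end

section \<open>Tools from real analysis\<close>

lemma uniformly_continuous_bounded_support:
  fixes f :: "'a::euclidean_space \<Rightarrow> 'b::real_normed_vector"
  assumes f: "continuous_on UNIV f" and S: "bounded S" "\<And>x. x \<notin> S \<Longrightarrow> f x = 0"
  shows "uniformly_continuous_on UNIV f"
  unfolding uniformly_continuous_on_def
proof (intro allI impI)
  fix e :: real assume e: "e > 0"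
  obtain b where b: "\<And>x. x \<in> S \<Longrightarrow> norm x \<le> b" using S(1) by (auto simp: bounded_iff)
  have "uniformly_continuous_on (cball 0 (b + 1)) f"
    by (rule compact_uniformly_continuous[OF continuous_on_subset[OF f]]) auto
  then obtain d where d: "d > 0" "\<And>x y. \<lbrakk>x \<in> cball 0 (b + 1); y \<in> cball 0 (b + 1); dist y x < d\<rbrakk> \<Longrightarrow> dist (f y) (f x) < e"
    using e unfolding uniformly_continuous_on_def by metis
  have "dist (f y) (f x) < e" if "dist y x < min d 1" for x y
  proof (cases "x \<in> cball 0 (b + 1) \<and> y \<in> cball 0 (b + 1)")
    case True
    then show ?thesis using d(2) that by auto
  next
    case False
    moreover have "norm y \<le> norm x + 1" "norm x \<le> norm y + 1"
      using that norm_triangle_sub[of x y] norm_triangle_sub[of y x] norm_minus_commute[of x y]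
      by (auto simp: dist_norm)
    ultimately have "norm x > b" "norm y > b" by auto
    then have "f x = 0" "f y = 0" using b S(2) by (meson not_le)+
    then show ?thesis using e by simp
  qed
  then show "\<exists>d>0. \<forall>x\<in>UNIV. \<forall>x'\<in>UNIV. dist x' x < d \<longrightarrow> dist (f x') (f x) < e"
    using d(1) by (intro exI[of _ "min d 1"]) auto
qed

lemma integrable_continuous_bounded_support:
  fixes f :: "'a::euclidean_space \<Rightarrow> 'b::{banach, second_countable_topology}"
  assumes f: "continuous_on UNIV f" and S: "bounded S" "\<And>x. x \<notin> S \<Longrightarrow> f x = 0"
  shows "integrable lborel f"
proof -
  obtain b where b: "S \<subseteq> cball 0 b"
    using S(1) by (auto simp: bounded_iff subset_iff)
  have "integrable lborel (\<lambda>x. indicator (cball 0 b) x *\<^sub>R f x)"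
    by (rule borel_integrable_compact[OF _ continuous_on_subset[OF f]]) auto
  also have "(\<lambda>x. indicator (cball 0 b) x *\<^sub>R f x) = f"
  proof
    fix x show "indicator (cball 0 b) x *\<^sub>R f x = f x"
      using b S(2)[of x] by (cases "x \<in> S") auto
  qed
  finally show ?thesis .
qed

lemma norm_matrix_vector_mult_le: "norm (A *v x) \<le> norm A * norm (x :: real^'n)"
  for A :: "real^'n^'m"
proof -
  have "(A *v x) $ i = A $ i \<bullet> x" for i
    by (simp add: matrix_vector_mult_def inner_vec_def)
  then have "norm (A *v x) = L2_set (\<lambda>i. \<bar>A $ i \<bullet> x\<bar>) UNIV" by (simp add: norm_vec_def)
  also have "\<dots> \<le> L2_set (\<lambda>i. norm x * norm (A $ i)) UNIV"
    by (intro L2_set_mono) (auto simp: mult.commute[of "norm x"] intro: Cauchy_Schwarz_ineq2)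
  also have "\<dots> = norm A * norm x"
    by (simp add: L2_set_right_distrib[symmetric] norm_vec_def[of A] mult.commute)
  finally show ?thesis .
qed

text \<open>Bounded support makes the Jacobian uniformly continuous, so the mean value inequality
  yields one \<open>d\<close> for all base points.\<close>

lemma cube_tests_uniform_Taylor:
  fixes \<phi> :: "real^'n \<Rightarrow> real^'m"
  assumes \<phi>: "\<phi> \<in> cube_tests" and e: "e > 0"
  obtains d where "d > 0"
    "\<And>x v. norm v < d \<Longrightarrow> norm (\<phi> (x + v) - \<phi> x - jacobian_matrix \<phi> x *v v) \<le> e * norm v"
proof -
  have C: "C_k (Suc 0) \<phi>" using \<phi> by (simp add: cube_tests_def)
  have "uniformly_continuous_on UNIV (jacobian_matrix \<phi>)"
    using C jacobian_matrix_eq_0_off_cube[OF \<phi>]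
    by (intro uniformly_continuous_bounded_support[OF _ bounded_unit_cube]) (auto simp: C_k_1_iff)
  then obtain d where d: "d > 0" "\<And>x y. dist y x < d \<Longrightarrow> dist (jacobian_matrix \<phi> y) (jacobian_matrix \<phi> x) < e"
    using e unfolding uniformly_continuous_on_def by (metis UNIV_I)
  have "norm (\<phi> (x + v) - \<phi> x - jacobian_matrix \<phi> x *v v) \<le> e * norm v" if v: "norm v < d" for x v
  proof -
    have "norm (\<phi> (x + v) - \<phi> x - jacobian_matrix \<phi> x *v (x + v - x)) \<le> norm (x + v - x) * e"
    proof (rule differentiable_bound_linearization[where S = "ball x d" and f' = "\<lambda>y. (*v) (jacobian_matrix \<phi> y)"])
      show "x + t *\<^sub>R (x + v - x) \<in> ball x d" if "t \<in> {0..1}" for t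
      proof -
        have "\<bar>t\<bar> * norm v \<le> 1 * norm v" using that by (intro mult_right_mono) auto
        then show ?thesis using v by (simp add: dist_norm)
      qed
      show "(\<phi> has_derivative (*v) (jacobian_matrix \<phi> y)) (at y within ball x d)" for y
        by (rule has_derivative_at_withinI[OF C_k_1_has_derivative[OF C]])
      show "x \<in> ball x d" using d by simp
      show "onorm ((*v) (jacobian_matrix \<phi> y) - (*v) (jacobian_matrix \<phi> x)) \<le> e" if "y \<in> ball x d" for y
        unfolding fun_diff_def
      proof (rule onorm_bound)
        fix v
        have "norm (jacobian_matrix \<phi> y - jacobian_matrix \<phi> x) \<le> e"
          using d(2)[of y x] that by (simp add: dist_norm norm_minus_commute less_imp_le)
        then show "norm (jacobian_matrix \<phi> y *v v - jacobian_matrix \<phi> x *v v) \<le> e * norm v"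
          unfolding matrix_vector_mult_diff_rdistrib[symmetric]
          by (meson norm_matrix_vector_mult_le order_trans mult_right_mono norm_ge_zero)
      qed (use e in auto)
    qed
    then show ?thesis by (simp add: mult.commute)
  qed
  with d(1) show ?thesis by (rule that)
qed

text \<open>The difference quotients of \<open>F\<close> have integral zero by translation
  invariance, and they approximate \<open>K\<close> uniformly on a fixed ball. This gives
  integration by parts without iterated integrals.\<close>

lemma lborel_integral_directional_derivative_eq_0:
  fixes F K :: "'a::euclidean_space \<Rightarrow> real"
  assumes F: "continuous_on UNIV F" and K: "continuous_on UNIV K"
    and D: "\<And>x t. ((\<lambda>t. F (x + t *\<^sub>R a)) has_real_derivative K (x + t *\<^sub>R a)) (at t)"
    and S: "bounded S" "\<And>x. x \<notin> S \<Longrightarrow> F x = 0" "\<And>x. x \<notin> S \<Longrightarrow> K x = 0"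
  shows "integral\<^sup>L lborel K = 0"
proof -
  obtain b where b: "\<And>x. x \<in> S \<Longrightarrow> norm x \<le> b" using S(1) by (auto simp: bounded_iff)
  \<comment> \<open>For steps t of size at most 1, both \<open>K\<close> and the difference quotient
    vanish off this ball, so a uniform error \<open>e\<close> costs at most
    \<open>e * measure lborel B\<close>.\<close>
  define B where "B = cball (0::'a) (b + norm a)"
  have intF: "integrable lborel F" and intK: "integrable lborel K"
    using integrable_continuous_bounded_support[OF F S(1,2)] integrable_continuous_bounded_support[OF K S(1,3)]
    by auto
  have bound: "\<bar>integral\<^sup>L lborel K\<bar> \<le> e * measure lborel B" if e: "e > 0" for e
  proof -
    obtain d where d: "d > 0" "\<And>x y. dist y x < d \<Longrightarrow> dist (K y) (K x) < e"
      using uniformly_continuous_bounded_support[OF K S(1,3)] e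
      unfolding uniformly_continuous_on_def by (metis UNIV_I)
    define t where "t = min 1 (d / (2 * (norm a + 1)))"
    have na: "norm a + 1 > 0" by (simp add: add_nonneg_pos)
    have t: "0 < t" "t \<le> 1" using d na by (auto simp: t_def)
    have td: "t * norm a < d"
    proof -
      have "t * norm a \<le> (d / (2 * (norm a + 1))) * norm a"
        by (intro mult_right_mono) (auto simp: t_def)
      also have "\<dots> \<le> d / 2" using na d by (simp add: field_simps)
      finally show ?thesis using d by linarith
    qed
    have tr: "integrable lborel (\<lambda>x. F (x + t *\<^sub>R a))"
    proof (rule integrable_continuous_bounded_support)
      show "continuous_on UNIV (\<lambda>x. F (x + t *\<^sub>R a))"
        by (rule continuous_on_compose2[OF F _ subset_UNIV]) (intro continuous_intros)
      show "bounded ((\<lambda>x. x - t *\<^sub>R a) ` S)"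
        using bounded_translation[OF S(1), of "- (t *\<^sub>R a)"] by simp
      show "F (x + t *\<^sub>R a) = 0" if "x \<notin> (\<lambda>x. x - t *\<^sub>R a) ` S" for x
        using that by (intro S(2)) (auto simp: image_iff)
    qed
    have pw: "\<bar>K x - (F (x + t *\<^sub>R a) - F x) / t\<bar> \<le> e * indicator B x" for x
    proof -
      have "\<exists>s>0. s < t \<and> F (x + t *\<^sub>R a) - F (x + 0 *\<^sub>R a) = (t - 0) * K (x + s *\<^sub>R a)"
        by (rule MVT2[OF t(1), of "\<lambda>t. F (x + t *\<^sub>R a)" "\<lambda>t. K (x + t *\<^sub>R a)"]) (rule D)
      then obtain s where s: "0 < s" "s < t" "(F (x + t *\<^sub>R a) - F x) / t = K (x + s *\<^sub>R a)"
        using t by auto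
      have sa: "s * norm a \<le> t * norm a" using s by (intro mult_right_mono) auto
      show ?thesis
      proof (cases "x \<in> B")
        case True
        have "dist (x + s *\<^sub>R a) x < d" using sa td s by (simp add: dist_norm)
        from d(2)[OF this] show ?thesis using True s(3) by (simp add: dist_real_def abs_minus_commute)
      next
        case False
        then have nx: "norm x > b + norm a" by (simp add: B_def)
        have "t * norm a \<le> 1 * norm a" using t by (intro mult_right_mono) auto
        then have "norm x - norm (s *\<^sub>R a) > b" using nx sa s by simp
        then have "norm (x + s *\<^sub>R a) > b" using norm_diff_ineq[of x "s *\<^sub>R a"] by linarith
        then have "x + s *\<^sub>R a \<notin> S" using b by force
        moreover have "x \<notin> S" using nx b[of x] norm_ge_zero[of a] by force
        ultimately show ?thesis using s(3) S(3) by (simp add: False)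
      qed
    qed
    have "\<bar>integral\<^sup>L lborel K\<bar> = \<bar>LINT x|lborel. K x - (F (x + t *\<^sub>R a) - F x) / t\<bar>"
      using intF intK tr lborel_integral_translation[OF borel_measurable_continuous_onI[OF F], of "t *\<^sub>R a"] by simp
    also have "\<dots> \<le> (LINT x|lborel. \<bar>K x - (F (x + t *\<^sub>R a) - F x) / t\<bar>)" by (rule integral_abs_bound)
    also have "\<dots> \<le> (LINT x|lborel. e * indicator B x)"
      by (intro integral_mono pw integrable_abs Bochner_Integration.integrable_diff integrable_divide intF intK tr)
         (auto simp: B_def intro!: integrable_real_indicator emeasure_bounded_finite[unfolded infinity_ennreal_def])
    also have "\<dots> = e * measure lborel B" by simp
    finally show ?thesis .
  qed
  show ?thesis
  proof (rule ccontr)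
    assume "integral\<^sup>L lborel K \<noteq> 0"
    then have p: "\<bar>integral\<^sup>L lborel K\<bar> > 0" by simp
    have m: "measure lborel B + 1 > 0" by (simp add: add_nonneg_pos)
    have "\<bar>integral\<^sup>L lborel K\<bar> \<le> (\<bar>integral\<^sup>L lborel K\<bar> / (measure lborel B + 1)) * measure lborel B"
      using p m by (intro bound) simp
    then have "\<bar>integral\<^sup>L lborel K\<bar> * (measure lborel B + 1) \<le> \<bar>integral\<^sup>L lborel K\<bar> * measure lborel B"
      using m by (simp add: field_simps)
    then show False using p by (simp add: distrib_left)
  qed
qed

text \<open>A discrete version of the identity \<open>\<integral> det D(a, b) = 0\<close>: both sides of
  \<open>\<integral> (\<Delta>\<^sub>s a) (\<Delta>\<^sub>t b) = \<integral> (\<Delta>\<^sub>-\<^sub>t a) (\<Delta>\<^sub>-\<^sub>s b)\<close> expand to the same four integrals up to translations.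
  Working with finite differences means that the functions need not be differentiable.\<close>

lemma discrete_Korn:
  fixes a b :: "'a::euclidean_space \<Rightarrow> real" and s t :: 'a
  assumes a: "continuous_on UNIV a" "\<And>x. x \<notin> S \<Longrightarrow> a x = 0"
    and b: "continuous_on UNIV b" "\<And>x. x \<notin> S \<Longrightarrow> b x = 0" and S: "bounded S"
  shows "(LINT x|lborel. (a (x + s) - a x)\<^sup>2) \<le>
    (LINT x|lborel. ((a (x + s) - a x) - (b (x + t) - b x))\<^sup>2) +
    (LINT x|lborel. (a (x + t) - a x)\<^sup>2) + (LINT x|lborel. (b (x + s) - b x)\<^sup>2)"
proof -
  have shift: "continuous_on UNIV (\<lambda>x. f (x + r))" if "continuous_on UNIV f" for f :: "'a \<Rightarrow> real" and r
    by (rule continuous_on_compose2[OF that _ subset_UNIV]) (intro continuous_intros)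
  have shift': "continuous_on UNIV (\<lambda>x. f (x - r))" if "continuous_on UNIV f" for f :: "'a \<Rightarrow> real" and r
    by (rule continuous_on_compose2[OF that _ subset_UNIV]) (intro continuous_intros)
  define S' where "S' = S \<union> (\<lambda>x. x - s) ` S \<union> (\<lambda>x. x - t) ` S \<union> (\<lambda>x. x + s) ` S \<union> (\<lambda>x. x + t) ` S"
  have S': "bounded S'"
    using S bounded_translation[OF S, of s] bounded_translation[OF S, of t]
      bounded_translation[OF S, of "-s"] bounded_translation[OF S, of "-t"]
    by (simp add: S'_def add.commute)
  have zs: "a x = 0" "a (x + s) = 0" "a (x + t) = 0" "a (x - s) = 0" "a (x - t) = 0"
     "b x = 0" "b (x + s) = 0" "b (x + t) = 0" "b (x - s) = 0" "b (x - t) = 0" if "x \<notin> S'" for x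
    using that by (auto intro!: a(2) b(2) simp: S'_def image_iff)
  note cont = continuous_intros a(1) b(1) shift[OF a(1)] shift[OF b(1)] shift'[OF a(1)] shift'[OF b(1)]
  have int: "integrable lborel f" if "continuous_on UNIV f" "\<And>x. x \<notin> S' \<Longrightarrow> f x = 0" for f :: "'a \<Rightarrow> real"
    by (rule integrable_continuous_bounded_support[OF that(1) S' that(2)])
  have tr: "(LINT x|lborel. f (x + r)) = integral\<^sup>L lborel f" if "continuous_on UNIV f" for f :: "'a \<Rightarrow> real" and r
    by (rule lborel_integral_translation[OF borel_measurable_continuous_onI[OF that]])
  have i: "integrable lborel (\<lambda>x. a (x + s) * b (x + t))" "integrable lborel (\<lambda>x. a (x + s) * b x)"
     "integrable lborel (\<lambda>x. a x * b (x + t))" "integrable lborel (\<lambda>x. a x * b x)"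
     "integrable lborel (\<lambda>x. a (x - t) * b (x - s))" "integrable lborel (\<lambda>x. a (x - t) * b x)"
     "integrable lborel (\<lambda>x. a x * b (x - s))"
    by (rule int; (intro cont | simp add: zs))+
  have 1: "(LINT x|lborel. a (x - t) * b (x - s)) = (LINT x|lborel. a (x + s) * b (x + t))"
    using tr[of "\<lambda>x. a (x - t) * b (x - s)" "s + t"] by (simp add: cont algebra_simps)
  have 2: "(LINT x|lborel. a x * b (x - s)) = (LINT x|lborel. a (x + s) * b x)"
    using tr[of "\<lambda>x. a x * b (x - s)" s] by (simp add: cont)
  have 3: "(LINT x|lborel. a (x - t) * b x) = (LINT x|lborel. a x * b (x + t))"
    using tr[of "\<lambda>x. a (x - t) * b x" t] by (simp add: cont)
  have "(LINT x|lborel. (a (x + s) - a x) * (b (x + t) - b x)) =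
      (LINT x|lborel. a (x + s) * b (x + t) - a (x + s) * b x - a x * b (x + t) + a x * b x)"
    by (simp add: algebra_simps)
  also have "\<dots> = (LINT x|lborel. a (x - t) * b (x - s) - a x * b (x - s) - a (x - t) * b x + a x * b x)"
    using i 1 2 3 by simp
  also have "\<dots> = (LINT x|lborel. (a x - a (x - t)) * (b x - b (x - s)))"
    by (simp add: algebra_simps)
  finally have det: "(LINT x|lborel. (a (x + s) - a x) * (b (x + t) - b x)) =
      (LINT x|lborel. (a x - a (x - t)) * (b x - b (x - s)))" .
  have i2: "integrable lborel (\<lambda>x. (a (x + s) - a x)\<^sup>2)" "integrable lborel (\<lambda>x. (b (x + t) - b x)\<^sup>2)"
    "integrable lborel (\<lambda>x. (a x - a (x - t))\<^sup>2)" "integrable lborel (\<lambda>x. (b x - b (x - s))\<^sup>2)"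
    "integrable lborel (\<lambda>x. ((a (x + s) - a x) - (b (x + t) - b x))\<^sup>2)"
    "integrable lborel (\<lambda>x. (a (x + s) - a x) * (b (x + t) - b x))"
    "integrable lborel (\<lambda>x. (a x - a (x - t)) * (b x - b (x - s)))"
    by (rule int; (intro cont | simp add: zs))+
  \<comment> \<open>Adding the second diagonal square gives the square of the difference plus twice
    the product. The identity \<open>det\<close> exchanges this product for one of the two
    off-diagonal differences, which their squares bound.\<close>
  have "(LINT x|lborel. (a (x + s) - a x)\<^sup>2) \<le> (LINT x|lborel. (a (x + s) - a x)\<^sup>2) + (LINT x|lborel. (b (x + t) - b x)\<^sup>2)"
    by simp
  also have "\<dots> = (LINT x|lborel. ((a (x + s) - a x) - (b (x + t) - b x))\<^sup>2 + 2 * ((a (x + s) - a x) * (b (x + t) - b x)))"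
    by (subst Bochner_Integration.integral_add[symmetric], (rule i2)+) (simp add: power2_eq_square algebra_simps)
  also have "\<dots> = (LINT x|lborel. ((a (x + s) - a x) - (b (x + t) - b x))\<^sup>2) +
      (LINT x|lborel. 2 * ((a x - a (x - t)) * (b x - b (x - s))))"
    using i2 det by simp
  also have "(LINT x|lborel. 2 * ((a x - a (x - t)) * (b x - b (x - s)))) \<le>
      (LINT x|lborel. (a x - a (x - t))\<^sup>2 + (b x - b (x - s))\<^sup>2)"
    by (intro integral_mono Bochner_Integration.integrable_add integrable_mult_right i2)
       (use sum_squares_bound[where 'a = real] in \<open>simp only: mult.assoc[symmetric]\<close>)
  also have "\<dots> = (LINT x|lborel. (a x - a (x - t))\<^sup>2) + (LINT x|lborel. (b x - b (x - s))\<^sup>2)"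
    by (intro Bochner_Integration.integral_add i2)
  also have "(LINT x|lborel. (a x - a (x - t))\<^sup>2) = (LINT x|lborel. (a (x + t) - a x)\<^sup>2)"
    using tr[of "\<lambda>x. (a x - a (x - t))\<^sup>2" t] by (simp add: cont)
  also have "(LINT x|lborel. (b x - b (x - s))\<^sup>2) = (LINT x|lborel. (b (x + s) - b x)\<^sup>2)"
    using tr[of "\<lambda>x. (b x - b (x - s))\<^sup>2" s] by (simp add: cont)
  finally show ?thesis by simp
qed

section \<open>The weak-type bound for the maximal function\<close>

lemma content_cball_scale:
  fixes c :: "'a::euclidean_space"
  shows "0 \<le> r \<Longrightarrow> measure lborel (cball c r) = measure lborel (cball (0::'a) 1) * r ^ DIM('a)"
  by (simp add: content_cball)

text \<open>Vitali's lemma selects countably many disjoint bad balls whose five-fold dilations cover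
  all bad centres. \<open>U\<close> is the union of these dilations, so it is measurable by
  construction and only has to contain the bad points.\<close>

lemma maximal_function_weak_bound:
  fixes p :: "'a::euclidean_space \<Rightarrow> real"
  assumes p: "integrable lborel p" "\<And>x. 0 \<le> p x" and l: "l > 0"
  obtains U where "U \<in> fmeasurable lborel" "measure lborel U \<le> 5 ^ DIM('a) / l * integral\<^sup>L lborel p"
    "\<And>x r. r > 0 \<Longrightarrow> l * measure lborel (cball x r) < (LINT y:cball x r|lborel. p y) \<Longrightarrow> x \<in> U"
proof -
  define \<omega> where "\<omega> = measure lborel (cball (0::'a) 1)"
  have \<omega>: "\<omega> > 0" by (simp add: \<omega>_def)
  define K where "K = {x. \<exists>r>0. l * measure lborel (cball x r) < (LINT y:cball x r|lborel. p y)}"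
  then have "\<forall>x\<in>K. \<exists>r. r > 0 \<and> l * measure lborel (cball x r) < (LINT y:cball x r|lborel. p y)"
    by blast
  from bchoice[OF this] obtain \<rho> where \<rho>: "\<And>x. x \<in> K \<Longrightarrow> \<rho> x > 0"
      "\<And>x. x \<in> K \<Longrightarrow> l * measure lborel (cball x (\<rho> x)) < (LINT y:cball x (\<rho> x)|lborel. p y)"
    by blast
  have sint: "set_integrable lborel (cball x r) p" for x r
    unfolding set_integrable_def using p(1) by (intro integrable_mult_indicator) auto
  have sint_le: "(LINT y:A|lborel. p y) \<le> integral\<^sup>L lborel p" if "A \<in> sets borel" for A
    unfolding set_lebesgue_integral_def using p that
    by (intro integral_mono integrable_mult_indicator) (auto simp: indicator_def)
  \<comment> \<open>Vitali's lemma needs bounded radii. A bad ball of radius at least 1 has measure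
    at least \<open>\<omega>\<close> times its radius, while the total integral of \<open>p\<close>
    bounds \<open>l\<close> times that measure.\<close>
  have \<rho>_le: "\<rho> x \<le> max 1 (integral\<^sup>L lborel p / (l * \<omega>))" if x: "x \<in> K" for x
  proof (cases "\<rho> x \<le> 1")
    case False
    then have "\<rho> x ^ 1 \<le> \<rho> x ^ DIM('a)" by (intro power_increasing) (auto simp: Suc_leI)
    then have "l * \<omega> * \<rho> x \<le> l * (\<omega> * \<rho> x ^ DIM('a))" using l \<omega> by simp
    also have "\<dots> = l * measure lborel (cball x (\<rho> x))"
      using \<rho>(1)[OF x] content_cball_scale[of "\<rho> x" x] by (simp add: \<omega>_def)
    also have "\<dots> \<le> integral\<^sup>L lborel p"
      using \<rho>(2)[OF x] sint_le[of "cball x (\<rho> x)"] by simp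
    finally have "\<rho> x \<le> integral\<^sup>L lborel p / (l * \<omega>)" using l \<omega> by (simp add: field_simps)
    then show ?thesis by simp
  qed simp
  obtain C where C: "countable C" "C \<subseteq> K" "pairwise (\<lambda>i j. disjnt (cball i (\<rho> i)) (cball j (\<rho> j))) C"
    "K \<subseteq> (\<Union>i\<in>C. cball i (5 * \<rho> i))"
  proof (rule Vitali_covering_lemma_cballs[where S = K and K = K and a = "\<lambda>x. x" and r = \<rho>])
    show "K \<subseteq> (\<Union>i\<in>K. cball i (\<rho> i))" using \<rho>(1) by (force intro: less_imp_le)
    show "0 < \<rho> i \<and> \<rho> i \<le> max 1 (integral\<^sup>L lborel p / (l * \<omega>))" if "i \<in> K" for i
      using \<rho>(1) \<rho>_le that by blast
  qed blast
  \<comment> \<open>For a finite subfamily, disjointness of the undilated balls lets their integrals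
    add up to at most the total one. A bound uniform over finite subfamilies passes to the countable
    union.\<close>
  have fin: "measure lborel (\<Union>i\<in>F. cball i (5 * \<rho> i)) \<le> 5 ^ DIM('a) / l * integral\<^sup>L lborel p"
    if F: "F \<subseteq> C" "finite F" for F
  proof -
    have disj: "disjoint_family_on (\<lambda>i. cball i (\<rho> i)) F"
      using C(3) F(1) by (fastforce simp: disjoint_family_on_def pairwise_def disjnt_def)
    have "measure lborel (\<Union>i\<in>F. cball i (5 * \<rho> i)) \<le> (\<Sum>i\<in>F. measure lborel (cball i (5 * \<rho> i)))"
      by (rule measure_UNION_le[OF F(2)]) simp
    also have "\<dots> \<le> (\<Sum>i\<in>F. 5 ^ DIM('a) / l * (LINT y:cball i (\<rho> i)|lborel. p y))"
    proof (rule sum_mono)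
      fix i assume "i \<in> F"
      then have i: "i \<in> K" using F C by auto
      have "measure lborel (cball i (5 * \<rho> i)) = 5 ^ DIM('a) / l * (l * measure lborel (cball i (\<rho> i)))"
        using \<rho>(1)[OF i] l by (simp add: content_cball_scale[of _ i] power_mult_distrib)
      also have "\<dots> \<le> 5 ^ DIM('a) / l * (LINT y:cball i (\<rho> i)|lborel. p y)"
        using \<rho>(2)[OF i] l by (intro mult_left_mono) auto
      finally show "measure lborel (cball i (5 * \<rho> i)) \<le> 5 ^ DIM('a) / l * (LINT y:cball i (\<rho> i)|lborel. p y)" .
    qed
    also have "\<dots> = 5 ^ DIM('a) / l * (LINT y:(\<Union>i\<in>F. cball i (\<rho> i))|lborel. p y)"
      by (subst set_integral_finite_Union[OF F(2) disj sint]) (auto simp: sum_distrib_left)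
    also have "\<dots> \<le> 5 ^ DIM('a) / l * integral\<^sup>L lborel p"
      using F(2) l by (intro mult_left_mono sint_le) auto
    finally show ?thesis .
  qed
  have fm: "cball i (5 * \<rho> i) \<in> fmeasurable lborel" for i :: 'a
    using emeasure_bounded_finite[OF bounded_cball, of i "5 * \<rho> i"] by (intro fmeasurableI) auto
  show ?thesis
  proof
    show "(\<Union>i\<in>C. cball i (5 * \<rho> i)) \<in> fmeasurable lborel"
      by (rule fmeasurable_UN_bound[OF C(1) fm fin])
    show "measure lborel (\<Union>i\<in>C. cball i (5 * \<rho> i)) \<le> 5 ^ DIM('a) / l * integral\<^sup>L lborel p"
      by (rule measure_UN_bound[OF C(1) fm fin])
    show "x \<in> (\<Union>i\<in>C. cball i (5 * \<rho> i))"
      if "r > 0" "l * measure lborel (cball x r) < (LINT y:cball x r|lborel. p y)" for x r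
      using subsetD[OF C(4), of x] that unfolding K_def by blast
  qed
qed

section \<open>Radial averages\<close>

text \<open>A radial weight carried by the unit ball; the square makes it C^1, so that integration
  by parts against it leaves no boundary term.\<close>

definition bump :: "real^2 \<Rightarrow> real" where
  "bump y = (max 0 (1 - y \<bullet> y))\<^sup>2"

definition bump_mass :: real where
  "bump_mass = integral\<^sup>L lborel bump"

definition bump_measure :: "(real^2) measure" where
  "bump_measure = density lborel (\<lambda>y. ennreal (bump y / bump_mass))"

lemma DERIV_max_0_square: "((\<lambda>s::real. (max 0 s)\<^sup>2) has_real_derivative 2 * max 0 s) (at s)"
proof (cases s "0 :: real" rule: linorder_cases)
  case less
  have "((\<lambda>s::real. 0) has_real_derivative 2 * max 0 s) (at s)" using less by simp
  then show ?thesis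
    by (rule has_field_derivative_transform_within_open[of _ _ _ "{..<0}"]) (use less in auto)
next
  case greater
  have "((\<lambda>s::real. s\<^sup>2) has_real_derivative 2 * max 0 s) (at s)"
    using greater by (auto intro!: derivative_eq_intros)
  then show ?thesis
    by (rule has_field_derivative_transform_within_open[of _ _ _ "{0<..}"]) (use greater in auto)
next
  case equal
  have "((\<lambda>h. ((max 0 h)\<^sup>2 - 0) / h) \<longlongrightarrow> 0) (at (0::real))"
  proof (rule tendsto_rabs_zero_cancel, rule tendsto_sandwich[of "\<lambda>_. 0" _ _ "\<lambda>h. \<bar>h\<bar>"])
    show "\<forall>\<^sub>F h in at (0::real). \<bar>((max 0 h)\<^sup>2 - 0) / h\<bar> \<le> \<bar>h\<bar>"
      by (rule always_eventually) (auto simp: max_def power2_eq_square)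
  qed (auto intro!: tendsto_eq_intros)
  then show ?thesis using equal by (simp add: has_field_derivative_iff)
qed

lemma bump_nonneg: "0 \<le> bump y" by (simp add: bump_def)

lemma bump_le_1: "bump y \<le> 1"
  unfolding bump_def by (rule power_le_one) auto

lemma bump_off: "y \<notin> cball 0 1 \<Longrightarrow> bump y = 0"
proof -
  assume "y \<notin> cball 0 1"
  then have "1 < (norm y)\<^sup>2" by (simp add: power_strict_increasing one_less_power)
  then show ?thesis by (simp add: bump_def power2_norm_eq_inner)
qed

lemma continuous_bump: "continuous_on A bump"
  unfolding bump_def by (intro continuous_intros)

lemma bump_measurable [measurable]: "bump \<in> borel_measurable borel"
  by (rule borel_measurable_continuous_onI[OF continuous_bump])

lemma bump_integrable: "integrable lborel bump"
  by (rule integrable_continuous_bounded_support[OF continuous_bump bounded_cball bump_off])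

lemma bump_mass_pos: "bump_mass > 0"
proof -
  have "0 < (LINT y|lborel. indicator (cball 0 (1/2) :: (real^2) set) y * (1/4::real))"
    by (simp add: content_cball unit_ball_vol_def)
  also have "\<dots> \<le> bump_mass"
    unfolding bump_mass_def
  proof (rule integral_mono)
    show "indicator (cball 0 (1/2)) y * (1/4) \<le> bump y" for y
    proof (cases "y \<in> cball 0 (1/2)")
      case True
      then have "(norm y)\<^sup>2 \<le> (1/2)\<^sup>2" by (intro power_mono) auto
      then have "y \<bullet> y \<le> 1/4" by (simp add: power2_norm_eq_inner power_one_over)
      then have "1 - y \<bullet> y \<ge> 1/2" by simp
      then have "(1/2)\<^sup>2 \<le> (max 0 (1 - y \<bullet> y))\<^sup>2" by (intro power_mono) auto
      then show ?thesis using True by (simp add: bump_def power2_eq_square)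
    qed (simp add: bump_nonneg)
    show "integrable lborel (\<lambda>y. indicator (cball 0 (1/2) :: (real^2) set) y * (1/4::real))"
      using emeasure_bounded_finite[OF bounded_cball, of "0::real^2" "1/2"]
      by (intro integrable_mult_left integrable_real_indicator) auto
  qed (rule bump_integrable)
  finally show ?thesis .
qed

lemma sets_bump_measure [measurable_cong, simp]: "sets bump_measure = sets borel"
  by (simp add: bump_measure_def)

lemma space_bump_measure [simp]: "space bump_measure = UNIV"
  by (simp add: bump_measure_def)

lemma integral_bump_measure:
  fixes f :: "real^2 \<Rightarrow> real"
  assumes "f \<in> borel_measurable borel"
  shows "integral\<^sup>L bump_measure f = (LINT y|lborel. (bump y / bump_mass) * f y)"
  unfolding bump_measure_def using assms bump_nonneg bump_mass_pos
  by (subst integral_density) auto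

lemma emeasure_bump_measure_UNIV: "emeasure bump_measure UNIV = 1"
proof -
  have "emeasure bump_measure UNIV = (\<integral>\<^sup>+ y. ennreal (bump y / bump_mass) \<partial>lborel)"
    by (simp add: bump_measure_def emeasure_density)
  also have "\<dots> = ennreal (LINT y|lborel. bump y / bump_mass)"
    using bump_nonneg bump_mass_pos bump_integrable by (intro nn_integral_eq_integral) auto
  also have "(LINT y|lborel. bump y / bump_mass) = 1"
    using bump_mass_pos by (simp add: bump_mass_def[symmetric])
  finally show ?thesis by simp
qed

lemma finite_measure_bump_measure: "finite_measure bump_measure"
  by standard (simp add: emeasure_bump_measure_UNIV)

lemma measure_bump_measure_UNIV: "measure bump_measure UNIV = 1"
  by (simp add: measure_def emeasure_bump_measure_UNIV)

lemma AE_bump_measure: "AE y in bump_measure. norm y \<le> 1"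
proof -
  have "norm y \<le> 1" if "0 < ennreal (bump y / bump_mass)" for y
    using that bump_off[of y] by (cases "norm y \<le> 1") auto
  then show ?thesis unfolding bump_measure_def by (subst AE_density) auto
qed

lemma bump_measure_integrable:
  fixes f :: "real^2 \<Rightarrow> 'b::{banach, second_countable_topology}"
  assumes f: "continuous_on UNIV f"
  shows "integrable bump_measure f"
proof -
  have "compact (f ` cball 0 1)"
    by (rule compact_continuous_image[OF continuous_on_subset[OF f]]) auto
  then obtain B where B: "\<And>y. y \<in> cball 0 1 \<Longrightarrow> norm (f y) \<le> B"
    by (meson compact_imp_bounded bounded_iff imageI)
  interpret finite_measure bump_measure by (rule finite_measure_bump_measure)
  show ?thesis
    by (rule integrable_const_bound[of _ B])
       (use AE_bump_measure B borel_measurable_continuous_onI[OF f] in \<open>auto elim: eventually_mono cong: measurable_cong_sets\<close>)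
qed

lemma bump_measure_integral_mono:
  fixes f g :: "real^2 \<Rightarrow> real"
  assumes "continuous_on UNIV f" "continuous_on UNIV g" "\<And>y. norm y \<le> 1 \<Longrightarrow> f y \<le> g y"
  shows "integral\<^sup>L bump_measure f \<le> integral\<^sup>L bump_measure g"
  using assms AE_bump_measure
  by (intro integral_mono_AE bump_measure_integrable) (auto elim: eventually_mono)

text \<open>The field \<open>(- y\<^sub>2, y\<^sub>1)\<close> generates rotations, which preserve the radial measure.\<close>

lemma bump_measure_rotation:
  fixes w a1 a2 :: "real^2 \<Rightarrow> real"
  assumes w: "\<And>y. (w has_derivative (\<lambda>v. a1 y * v $ 1 + a2 y * v $ 2)) (at y)"
    and a: "continuous_on UNIV a1" "continuous_on UNIV a2"
  shows "(LINT y|bump_measure. a2 y * y $ 1 - a1 y * y $ 2) = 0"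
proof -
  define m where "m y = max 0 (1 - y \<bullet> y)" for y :: "real^2"
  have m_off: "m y = 0" if "y \<notin> cball 0 1" for y
    using bump_off[OF that] by (simp add: bump_def m_def)
  have cw: "continuous_on UNIV w"
    using w by (intro continuous_at_imp_continuous_on ballI has_derivative_continuous)
  have cm: "continuous_on UNIV m" unfolding m_def by (intro continuous_intros)
  note cont = continuous_intros cw cm a continuous_bump continuous_on_component
  have dw: "((\<lambda>t. w (x + t *\<^sub>R e)) has_real_derivative a1 (x + t *\<^sub>R e) * e $ 1 + a2 (x + t *\<^sub>R e) * e $ 2) (at t)"
    for x e t
  proof -
    have "((\<lambda>t. w (x + t *\<^sub>R e)) has_derivative (\<lambda>h. a1 (x + t *\<^sub>R e) * (h *\<^sub>R e) $ 1 + a2 (x + t *\<^sub>R e) * (h *\<^sub>R e) $ 2)) (at t)"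
      by (rule has_derivative_compose[OF _ w]) (auto intro!: derivative_eq_intros)
    moreover have "(\<lambda>h. a1 (x + t *\<^sub>R e) * (h *\<^sub>R e) $ 1 + a2 (x + t *\<^sub>R e) * (h *\<^sub>R e) $ 2) =
        (*) (a1 (x + t *\<^sub>R e) * e $ 1 + a2 (x + t *\<^sub>R e) * e $ 2)"
      by (auto simp: algebra_simps)
    ultimately show ?thesis by (simp add: has_field_derivative_def)
  qed
  have db: "((\<lambda>t. bump (x + t *\<^sub>R axis i 1)) has_real_derivative - 4 * (x + t *\<^sub>R axis i 1) $ i * m (x + t *\<^sub>R axis i 1)) (at t)"
    for x t i
  proof -
    have "((\<lambda>t. 1 - (x + t *\<^sub>R axis i 1) \<bullet> (x + t *\<^sub>R axis i 1)) has_real_derivative - 2 * (x + t *\<^sub>R axis i 1) $ i) (at t)"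
    proof -
      have "(\<lambda>t. 1 - (x + t *\<^sub>R axis i 1) \<bullet> (x + t *\<^sub>R axis i 1)) = (\<lambda>t. 1 - (x \<bullet> x + 2 * t * x $ i + t\<^sup>2))"
        by (auto simp: fun_eq_iff inner_add inner_axis inner_axis' power2_eq_square algebra_simps)
      then show ?thesis by (auto intro!: derivative_eq_intros simp: algebra_simps)
    qed
    from DERIV_chain'[OF this DERIV_max_0_square] show ?thesis
      by (simp add: bump_def m_def algebra_simps)
  qed
  \<comment> \<open>\<open>K1\<close> and \<open>K2\<close> are the derivatives of \<open>F1\<close>
    and \<open>F2\<close> in directions 1 and 2. As the weight is radial, both contain the same term
    in \<open>w\<close>; it cancels in \<open>K2 - K1\<close> and leaves the rotational
    derivative.\<close>
  define F1 where "F1 y = w y * y $ 2 * bump y" for y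
  define F2 where "F2 y = w y * y $ 1 * bump y" for y
  define K1 where "K1 y = a1 y * y $ 2 * bump y - 4 * w y * y $ 1 * y $ 2 * m y" for y
  define K2 where "K2 y = a2 y * y $ 1 * bump y - 4 * w y * y $ 1 * y $ 2 * m y" for y
  have d1: "((\<lambda>t. F1 (x + t *\<^sub>R axis 1 1)) has_real_derivative K1 (x + t *\<^sub>R axis 1 1)) (at t)" for x t
  proof -
    have "((\<lambda>t. w (x + t *\<^sub>R axis 1 1) * (x $ 2) * bump (x + t *\<^sub>R axis 1 1)) has_real_derivative K1 (x + t *\<^sub>R axis 1 1)) (at t)"
      by (rule derivative_eq_intros dw db refl)+ (simp add: K1_def axis_def algebra_simps)
    then show ?thesis by (simp add: F1_def axis_def)
  qed
  have d2: "((\<lambda>t. F2 (x + t *\<^sub>R axis 2 1)) has_real_derivative K2 (x + t *\<^sub>R axis 2 1)) (at t)" for x t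
  proof -
    have "((\<lambda>t. w (x + t *\<^sub>R axis 2 1) * (x $ 1) * bump (x + t *\<^sub>R axis 2 1)) has_real_derivative K2 (x + t *\<^sub>R axis 2 1)) (at t)"
      by (rule derivative_eq_intros dw db refl)+ (simp add: K2_def axis_def algebra_simps)
    then show ?thesis by (simp add: F2_def axis_def)
  qed
  have cK: "continuous_on UNIV K1" "continuous_on UNIV K2" and cF: "continuous_on UNIV F1" "continuous_on UNIV F2"
    unfolding K1_def K2_def F1_def F2_def by (intro cont)+
  have off: "F1 y = 0" "F2 y = 0" "K1 y = 0" "K2 y = 0" if "y \<notin> cball 0 1" for y
    using m_off[OF that] bump_off[OF that] by (simp_all add: F1_def F2_def K1_def K2_def)
  have I1: "integral\<^sup>L lborel K1 = 0"
    by (rule lborel_integral_directional_derivative_eq_0[OF cF(1) cK(1) d1 bounded_cball off(1,3)])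
  have I2: "integral\<^sup>L lborel K2 = 0"
    by (rule lborel_integral_directional_derivative_eq_0[OF cF(2) cK(2) d2 bounded_cball off(2,4)])
  have int: "integrable lborel K1" "integrable lborel K2"
    by (rule integrable_continuous_bounded_support[OF cK(1) bounded_cball off(3)], assumption)
       (rule integrable_continuous_bounded_support[OF cK(2) bounded_cball off(4)], assumption)
  have "(LINT y|bump_measure. a2 y * y $ 1 - a1 y * y $ 2) = (LINT y|lborel. (bump y / bump_mass) * (a2 y * y $ 1 - a1 y * y $ 2))"
    by (intro integral_bump_measure borel_measurable_continuous_onI cont)
  also have "\<dots> = (LINT y|lborel. (K2 y - K1 y) / bump_mass)"
    by (intro Bochner_Integration.integral_cong) (auto simp: K1_def K2_def field_simps)
  also have "\<dots> = 0" using int I1 I2 by simp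
  finally show ?thesis .
qed

section \<open>Control of radial averages by the scalar defect\<close>

definition scalar_defect :: "real^2^2 \<Rightarrow> real" where
  "scalar_defect A = \<bar>A $ 1 $ 1 - A $ 2 $ 2\<bar> + \<bar>A $ 1 $ 2\<bar> + \<bar>A $ 2 $ 1\<bar>"

lemma scalar_defect_nonneg: "0 \<le> scalar_defect A"
  by (simp add: scalar_defect_def)

lemma matrix_vector_mult_2: "(A *v x) $ i = A $ i $ 1 * x $ 1 + A $ i $ 2 * x $ 2"
  for A :: "real^2^2"
  by (simp add: matrix_vector_mult_def sum_2)

lemma cube_tests_continuous_jacobian:
  fixes u :: "real^'n \<Rightarrow> real^'m"
  assumes "u \<in> cube_tests"
  shows "continuous_on UNIV (\<lambda>y. jacobian_matrix u (x + r *\<^sub>R y) $ i $ j)"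
proof -
  have "continuous_on UNIV (jacobian_matrix u)" using assms by (simp add: cube_tests_def C_k_1_iff)
  then have "continuous_on UNIV (\<lambda>y. jacobian_matrix u (x + r *\<^sub>R y))"
    by (rule continuous_on_compose2[OF _ _ subset_UNIV]) (intro continuous_intros)
  then show ?thesis by (intro continuous_on_component)
qed

text \<open>This is \<open>bump_measure_rotation\<close> for component \<open>i\<close> of the
  rescaling of \<open>u\<close> to the ball of radius \<open>r\<close>, whose Jacobian at y is that
  of \<open>u\<close> at \<open>x + r *\<^sub>R y\<close>.\<close>

lemma cube_tests_rotation:
  fixes u :: "real^2 \<Rightarrow> real^2"
  assumes u: "u \<in> cube_tests"
  shows "(LINT y|bump_measure. jacobian_matrix u (x + r *\<^sub>R y) $ i $ 2 * y $ 1 -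
    jacobian_matrix u (x + r *\<^sub>R y) $ i $ 1 * y $ 2) = 0"
proof -
  have C: "C_k (Suc 0) u" using u by (simp add: cube_tests_def)
  \<comment> \<open>Dividing by \<open>r\<close> fails at \<open>r = 0\<close>, a radius that does
    occur on the good set; there a linear map with the constant Jacobian serves instead.\<close>
  define w where "w = (if r = 0 then (\<lambda>y. jacobian_matrix u x *v y) else (\<lambda>y. u (x + r *\<^sub>R y) /\<^sub>R r))"
  have w: "(w has_derivative ((*v) (jacobian_matrix u (x + r *\<^sub>R y)))) (at y)" for y
  proof (cases "r = 0")
    case False
    then show ?thesis
      using C_k_1_has_derivative[OF C_k_1_affine(1)[OF C False, of x], of y]
      by (simp add: w_def C_k_1_affine(2)[OF C False])
  qed (simp add: w_def bounded_linear_imp_has_derivative)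
  have "((\<lambda>y. w y $ i) has_derivative (\<lambda>v. jacobian_matrix u (x + r *\<^sub>R y) $ i $ 1 * v $ 1 +
      jacobian_matrix u (x + r *\<^sub>R y) $ i $ 2 * v $ 2)) (at y)" for y
    using bounded_linear.has_derivative[OF bounded_linear_vec_nth w, of i y]
    by (simp add: matrix_vector_mult_2)
  moreover have "continuous_on UNIV (\<lambda>y. jacobian_matrix u (x + r *\<^sub>R y) $ i $ j)" for j
    by (rule cube_tests_continuous_jacobian[OF u])
  ultimately show ?thesis by (intro bump_measure_rotation) auto
qed

text \<open>The rotation identity trades the entries of the Jacobian that are not controlled by
  \<^const>\<open>scalar_defect\<close> for those that are.\<close>

lemma radial_derivative_le_scalar_defect:
  fixes u :: "real^2 \<Rightarrow> real^2"
  assumes u: "u \<in> cube_tests"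
  shows "\<bar>LINT y|bump_measure. (jacobian_matrix u (x + r *\<^sub>R y) *v y) $ i\<bar> \<le>
    (LINT y|bump_measure. scalar_defect (jacobian_matrix u (x + r *\<^sub>R y)))"
proof -
  define J where "J y = jacobian_matrix u (x + r *\<^sub>R y)" for y
  have cJ: "continuous_on UNIV (\<lambda>y. J y $ i $ j)" for i j
    unfolding J_def by (rule cube_tests_continuous_jacobian[OF u])
  note cont = continuous_intros cJ continuous_on_component
  have y: "\<bar>y $ j\<bar> \<le> 1" if "norm y \<le> 1" for y :: "real^2" and j
    using component_le_norm_cart[of y j] that by linarith
  have bound: "\<bar>integral\<^sup>L bump_measure f\<bar> \<le> (LINT y|bump_measure. scalar_defect (J y))"
    if "continuous_on UNIV f" "\<And>y. norm y \<le> 1 \<Longrightarrow> \<bar>f y\<bar> \<le> scalar_defect (J y)" for f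
  proof -
    have "\<bar>integral\<^sup>L bump_measure f\<bar> \<le> (LINT y|bump_measure. \<bar>f y\<bar>)" by (rule integral_abs_bound)
    also have "\<dots> \<le> (LINT y|bump_measure. scalar_defect (J y))"
      unfolding scalar_defect_def
      by (intro bump_measure_integral_mono that(2)[unfolded scalar_defect_def]; (intro cont that(1))?)
    finally show ?thesis .
  qed
  have le: "\<bar>a * y $ 1 + (b + c) * y $ 2\<bar> \<le> \<bar>a\<bar> + \<bar>b\<bar> + \<bar>c\<bar>" "\<bar>(b + c) * y $ 1 + a * y $ 2\<bar> \<le> \<bar>a\<bar> + \<bar>b\<bar> + \<bar>c\<bar>"
    if "norm y \<le> 1" for a b c and y :: "real^2"
  proof -
    have m: "\<bar>q * y $ j\<bar> \<le> \<bar>q\<bar>" for q j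
      using mult_left_mono[OF y[OF that, of j], of "\<bar>q\<bar>"] by (simp add: abs_mult)
    show "\<bar>a * y $ 1 + (b + c) * y $ 2\<bar> \<le> \<bar>a\<bar> + \<bar>b\<bar> + \<bar>c\<bar>" "\<bar>(b + c) * y $ 1 + a * y $ 2\<bar> \<le> \<bar>a\<bar> + \<bar>b\<bar> + \<bar>c\<bar>"
      using m[of a 1] m[of "b + c" 2] m[of "b + c" 1] m[of a 2] by linarith+
  qed
  consider "i = 1" | "i = 2" using exhaust_2 by blast
  then show ?thesis unfolding J_def[symmetric]
  proof cases
    case 1
    \<comment> \<open>Row 1 of \<open>J y *v y\<close> is \<open>f y\<close> plus the rotation
      expression of row 2, which averages to zero. The coefficients left in \<open>f\<close> are the
      diagonal difference and off-diagonal entries.\<close>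
    define f where "f y = (J y $ 1 $ 1 - J y $ 2 $ 2) * y $ 1 + (J y $ 1 $ 2 + J y $ 2 $ 1) * y $ 2" for y
    have cf: "continuous_on UNIV f" unfolding f_def by (intro cont)
    have "(LINT y|bump_measure. (J y *v y) $ i) =
      (LINT y|bump_measure. f y + (J y $ 2 $ 2 * y $ 1 - J y $ 2 $ 1 * y $ 2))"
      unfolding 1 by (simp add: f_def matrix_vector_mult_2 algebra_simps)
    also have "\<dots> = integral\<^sup>L bump_measure f"
      using cube_tests_rotation[OF u, of x r 2, folded J_def]
      by (subst Bochner_Integration.integral_add) (intro bump_measure_integrable cf cont | simp)+
    also have "\<bar>\<dots>\<bar> \<le> (LINT y|bump_measure. scalar_defect (J y))"
      by (rule bound[OF cf]) (simp add: f_def scalar_defect_def le(1))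
    finally show "\<bar>LINT y|bump_measure. (J y *v y) $ i\<bar> \<le> (LINT y|bump_measure. scalar_defect (J y))" .
  next
    case 2
    \<comment> \<open>Row 2 is likewise \<open>f y\<close> minus the rotation expression of row
      1.\<close>
    define f where "f y = (J y $ 2 $ 1 + J y $ 1 $ 2) * y $ 1 + (J y $ 2 $ 2 - J y $ 1 $ 1) * y $ 2" for y
    have cf: "continuous_on UNIV f" unfolding f_def by (intro cont)
    have "(LINT y|bump_measure. (J y *v y) $ i) =
      (LINT y|bump_measure. f y - (J y $ 1 $ 2 * y $ 1 - J y $ 1 $ 1 * y $ 2))"
      unfolding 2 by (simp add: f_def matrix_vector_mult_2 algebra_simps)
    also have "\<dots> = integral\<^sup>L bump_measure f"
      using cube_tests_rotation[OF u, of x r 1, folded J_def]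
      by (subst Bochner_Integration.integral_diff) (intro bump_measure_integrable cf cont | simp)+
    also have "\<bar>\<dots>\<bar> \<le> (LINT y|bump_measure. scalar_defect (J y))"
    proof (rule bound[OF cf])
      fix y :: "real^2" assume "norm y \<le> 1"
      from le(2)[OF this, of "J y $ 2 $ 1" "J y $ 1 $ 2" "J y $ 2 $ 2 - J y $ 1 $ 1"]
      show "\<bar>f y\<bar> \<le> scalar_defect (J y)" by (simp add: f_def scalar_defect_def)
    qed
    finally show "\<bar>LINT y|bump_measure. (J y *v y) $ i\<bar> \<le> (LINT y|bump_measure. scalar_defect (J y))" .
  qed
qed

text \<open>Taylor's formula is averaged for the displacement
  \<open>h *\<^sub>R axis j 1 + (r' - r) *\<^sub>R y\<close>. The part caused by the changing radius
  is a radial derivative and costs only the scalar defect, so the radius may vary with the base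
  point at unit speed.\<close>

lemma averaged_increment:
  fixes u :: "real^2 \<Rightarrow> real^2"
  assumes u: "u \<in> cube_tests" and e: "0 \<le> e"
    and d: "\<And>x v. norm v < d \<Longrightarrow> norm (u (x + v) - u x - jacobian_matrix u x *v v) \<le> e * norm v"
    and h: "0 \<le> h" "2 * h < d" and r: "\<bar>r' - r\<bar> \<le> h"
  shows "\<bar>(LINT y|bump_measure. u (x + h *\<^sub>R axis j 1 + r' *\<^sub>R y) $ i) - (LINT y|bump_measure. u (x + r *\<^sub>R y) $ i)
    - h * (LINT y|bump_measure. jacobian_matrix u (x + r *\<^sub>R y) $ i $ j)\<bar>
    \<le> h * (LINT y|bump_measure. scalar_defect (jacobian_matrix u (x + r *\<^sub>R y))) + 2 * e * h"
proof -
  have C: "C_k (Suc 0) u" using u by (simp add: cube_tests_def)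
  define J where "J y = jacobian_matrix u (x + r *\<^sub>R y)" for y
  have cJ: "continuous_on UNIV (\<lambda>y. J y $ i $ j)" for i j
    unfolding J_def by (rule cube_tests_continuous_jacobian[OF u])
  have cu: "continuous_on UNIV u"
    using C_k_1_has_derivative[OF C] by (intro continuous_at_imp_continuous_on ballI has_derivative_continuous)
  have cu': "continuous_on UNIV (\<lambda>y. u (q + s *\<^sub>R y) $ i)" for q s
    by (intro continuous_on_component continuous_on_compose2[OF cu _ subset_UNIV] continuous_intros)
  have cJy: "continuous_on UNIV (\<lambda>y. (J y *v y) $ i)"
    unfolding matrix_vector_mult_2 by (intro continuous_intros cJ continuous_on_component)
  note int = bump_measure_integrable[OF cu'] bump_measure_integrable[OF cJ] bump_measure_integrable[OF cJy]
  define q where "q = x + h *\<^sub>R axis j 1"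
  \<comment> \<open>\<open>E\<close> is component \<open>i\<close> of the Taylor remainder. The
    displacement has length at most \<open>2 * h\<close>, which explains the hypothesis
    \<open>2 * h < d\<close> and the error \<open>2 * e * h\<close>.\<close>
  define E where "E y = u (q + r' *\<^sub>R y) $ i - u (x + r *\<^sub>R y) $ i - h * J y $ i $ j - (r' - r) * (J y *v y) $ i" for y
  have cE: "continuous_on UNIV E"
    unfolding E_def by (intro continuous_intros cu' cJ cJy)
  have E: "\<bar>E y\<bar> \<le> 2 * e * h" if y: "norm y \<le> 1" for y
  proof -
    define v where "v = h *\<^sub>R axis j 1 + (r' - r) *\<^sub>R y"
    have "norm v \<le> norm (h *\<^sub>R axis j (1::real)) + norm ((r' - r) *\<^sub>R y)"
      unfolding v_def by (rule norm_triangle_ineq)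
    also have "\<dots> \<le> h + h * 1"
      using h r y unfolding norm_scaleR by (intro add_mono mult_mono) auto
    finally have nv: "norm v \<le> 2 * h" by simp
    have "x + r *\<^sub>R y + v = q + r' *\<^sub>R y" by (simp add: v_def q_def algebra_simps)
    moreover have "(J y *v v) $ i = h * J y $ i $ j + (r' - r) * (J y *v y) $ i"
      using exhaust_2[of j] by (auto simp: matrix_vector_mult_2 v_def axis_def algebra_simps)
    ultimately have "E y = (u (x + r *\<^sub>R y + v) - u (x + r *\<^sub>R y) - jacobian_matrix u (x + r *\<^sub>R y) *v v) $ i"
      by (simp add: E_def J_def)
    also have "\<bar>\<dots>\<bar> \<le> norm (u (x + r *\<^sub>R y + v) - u (x + r *\<^sub>R y) - jacobian_matrix u (x + r *\<^sub>R y) *v v)"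
      by (rule component_le_norm_cart)
    also have "\<dots> \<le> e * norm v" using nv h by (intro d) simp
    also have "\<dots> \<le> e * (2 * h)" using nv e by (rule mult_left_mono)
    finally show ?thesis by simp
  qed
  have "\<bar>integral\<^sup>L bump_measure E\<bar> \<le> (LINT y|bump_measure. \<bar>E y\<bar>)" by (rule integral_abs_bound)
  also have "\<dots> \<le> (LINT y|bump_measure. 2 * e * h)"
    by (rule bump_measure_integral_mono[OF _ _ E]) (intro continuous_intros cE)+
  also have "\<dots> = 2 * e * h" by (simp add: measure_bump_measure_UNIV)
  finally have 1: "\<bar>integral\<^sup>L bump_measure E\<bar> \<le> 2 * e * h" .
  have 2: "integral\<^sup>L bump_measure E = (LINT y|bump_measure. u (q + r' *\<^sub>R y) $ i) - (LINT y|bump_measure. u (x + r *\<^sub>R y) $ i)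
    - h * (LINT y|bump_measure. J y $ i $ j) - (r' - r) * (LINT y|bump_measure. (J y *v y) $ i)"
    unfolding E_def using int by simp
  have "\<bar>(r' - r) * (LINT y|bump_measure. (J y *v y) $ i)\<bar> \<le> h * (LINT y|bump_measure. scalar_defect (J y))"
    unfolding abs_mult using r h radial_derivative_le_scalar_defect[OF u, of x r i]
    by (intro mult_mono) (auto simp: J_def)
  then show ?thesis using 1 2 unfolding J_def q_def by linarith
qed

section \<open>A weak-type Korn inequality\<close>

lemma emeasure_translation_vimage:
  fixes U :: "'a::euclidean_space set"
  assumes "U \<in> sets borel"
  shows "{x. x + s \<in> U} \<in> sets borel" "emeasure lborel {x. x + s \<in> U} = emeasure lborel U"
proof -
  have "(+) s -` U \<inter> space borel \<in> sets borel" by (rule measurable_sets[OF _ assms]) auto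
  then show "{x. x + s \<in> U} \<in> sets borel" by (simp add: vimage_def add.commute)
  have "emeasure lborel U = emeasure (distr lborel borel ((+) s)) U" by (simp add: lborel_distr_plus)
  also have "\<dots> = emeasure lborel ((+) s -` U \<inter> space lborel)"
    using assms by (intro emeasure_distr) auto
  finally show "emeasure lborel {x. x + s \<in> U} = emeasure lborel U"
    by (simp add: vimage_def add.commute)
qed

lemma bump_mass_le: "bump_mass \<le> measure lborel (cball (0::real^2) 1)"
proof -
  have "bump_mass \<le> (LINT y|lborel. indicator (cball (0::real^2) 1) y)"
    unfolding bump_mass_def
  proof (rule integral_mono[OF bump_integrable])
    show "integrable lborel (indicat_real (cball (0::real^2) 1))"
      using emeasure_bounded_finite[OF bounded_cball, of "0::real^2" 1] by (intro integrable_real_indicator) auto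
    show "bump y \<le> indicator (cball 0 1) y" for y
      using bump_le_1[of y] bump_off[of y] by (cases "y \<in> cball 0 1") auto
  qed
  then show ?thesis by simp
qed

text \<open>The good set is the cube without \<open>U\<close>, a translate of \<open>U\<close>, and
  \<open>W\<close>. The first two have measure at most 1/8 each by the maximal bound, the third at
  most 1/4 by the L^2 estimate. Off them the increment of \<open>u\<close> equals that of the
  average \<open>v\<close> and is small, and Taylor's formula passes to the derivative.\<close>

theorem scalar_defect_controls_trace:
  obtains \<delta> where "\<delta> > 0" "\<And>u :: real^2 \<Rightarrow> real^2. u \<in> cube_tests \<Longrightarrow>
      (LINT x:unit_cube|lborel. scalar_defect (jacobian_matrix u x)) < \<delta> \<Longrightarrow>
      \<exists>E\<in>sets borel. E \<subseteq> unit_cube \<and> 1/2 \<le> measure lborel E \<and> (\<forall>x\<in>E. \<bar>jacobian_matrix u x $ 1 $ 1\<bar> \<le> 1/4)"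
proof -
  \<comment> \<open>\<open>\<Lambda>\<close> will bound the averaged scalar defect; its value makes
    \<open>14700 * \<Lambda>\<^sup>2 \<le> 1/256\<close> in the L^2 estimate.\<close>
  define \<Lambda> :: real where "\<Lambda> = 1/2000"
  define \<omega> where "\<omega> = measure lborel (cball (0::real^2) 1)"
  \<comment> \<open>A ball of radius r about \<open>x\<close> will lie in one of radius 3 r about a
    good point, and the density of \<open>bump_measure\<close> is at most
    \<open>1 / bump_mass\<close>. The threshold \<open>l\<close> therefore yields averages of at
    most \<open>9 * \<omega> * l / bump_mass = \<Lambda>\<close>.\<close>
  define l where "l = bump_mass * \<Lambda> / (9 * \<omega>)"
  \<comment> \<open>The weak bound in dimension 2 then gives the bad set measure at most
    \<open>25 / l * \<delta> = 1/8\<close>.\<close>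
  define \<delta> where "\<delta> = l / 200"
  have \<omega>_pi: "\<omega> = pi" by (simp add: \<omega>_def content_cball unit_ball_vol_2)
  then have \<omega>: "3 < \<omega>" "\<omega> < 4" using pi_gt3 pi_less_4 by auto
  have l: "l > 0" using \<omega> bump_mass_pos by (simp add: l_def \<Lambda>_def)
  have \<delta>: "\<delta> > 0" using l by (simp add: \<delta>_def)
  have ball_meas: "measure lborel (cball x r) = \<omega> * r\<^sup>2" if "r \<ge> 0" for x :: "real^2" and r
    using content_cball_scale[OF that, of x] by (simp add: \<omega>_def)
  show ?thesis
  proof (rule that[OF \<delta>])
    fix u :: "real^2 \<Rightarrow> real^2"
    assume u: "u \<in> cube_tests" and small: "(LINT x:unit_cube|lborel. scalar_defect (jacobian_matrix u x)) < \<delta>"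
    define p where "p x = scalar_defect (jacobian_matrix u x)" for x
    have p_nonneg: "0 \<le> p x" for x by (simp add: p_def scalar_defect_nonneg)
    have cp: "continuous_on UNIV p"
      using u unfolding p_def scalar_defect_def
      by (intro continuous_intros) (simp_all add: cube_tests_def C_k_1_iff)
    have p_off: "p x = 0" if "x \<notin> unit_cube" for x
      using jacobian_matrix_eq_0_off_cube[OF u that] by (simp add: p_def scalar_defect_def)
    have intp: "integrable lborel p"
      by (rule integrable_continuous_bounded_support[OF cp bounded_unit_cube p_off])
    have "(LINT x:unit_cube|lborel. p x) = integral\<^sup>L lborel p"
      unfolding set_lebesgue_integral_def
      by (intro Bochner_Integration.integral_cong) (use p_off in \<open>auto simp: indicator_def\<close>)
    then have p_small: "integral\<^sup>L lborel p < \<delta>" using small by (simp add: p_def)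
    define I where "I x r = (LINT y:cball x r|lborel. p y)" for x r
    have I_int: "set_integrable lborel A p" if "A \<in> sets borel" for A
      unfolding set_integrable_def using intp that by (intro integrable_mult_indicator) auto
    have I_mono: "I x r \<le> I x' r'" if "cball x r \<subseteq> cball x' r'" for x r x' r'
      unfolding I_def set_lebesgue_integral_def
      by (intro integral_mono I_int[unfolded set_integrable_def])
         (use that p_nonneg in \<open>auto simp: indicator_def\<close>)
    have I_le: "I x r < \<delta>" for x r
    proof -
      have "I x r \<le> integral\<^sup>L lborel p"
        unfolding I_def set_lebesgue_integral_def
        by (intro integral_mono I_int[unfolded set_integrable_def] intp)
           (use p_nonneg in \<open>auto simp: indicator_def\<close>)
      then show ?thesis using p_small by simp
    qed
    define G where "G = {x. \<forall>r>0. I x r \<le> l * (\<omega> * r\<^sup>2)}"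
    have G_D: "I x r \<le> l * (\<omega> * r\<^sup>2)" if "x \<in> G" "r > 0" for x r
      using that by (simp add: G_def)
    obtain U where U: "U \<in> fmeasurable lborel" "measure lborel U \<le> 5 ^ DIM(real^2) / l * integral\<^sup>L lborel p"
      and U_bad: "\<And>x r. r > 0 \<Longrightarrow> l * measure lborel (cball x r) < (LINT y:cball x r|lborel. p y) \<Longrightarrow> x \<in> U"
      using maximal_function_weak_bound[OF intp p_nonneg l] by blast
    have G_U: "x \<in> G" if "x \<notin> U" for x
      unfolding G_def using U_bad[of _ x] that ball_meas[of _ x] by (force simp: I_def not_less)
    have U_small: "measure lborel U \<le> 1/8"
    proof -
      have "5 ^ DIM(real^2) / l * integral\<^sup>L lborel p \<le> 25 / l * \<delta>"
        using p_small l by (intro mult_mono) (auto intro: integral_nonneg_AE simp: p_nonneg)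
      also have "\<dots> = 1/8" using l by (simp add: \<delta>_def)
      finally show ?thesis using U(2) by linarith
    qed
    have cube_norm: "norm x < 2" if "x \<in> unit_cube" for x :: "real^2"
    proof -
      have "norm x \<le> (\<Sum>i\<in>UNIV. \<bar>x $ i\<bar>)" by (rule norm_le_l1_cart)
      also have "\<dots> = \<bar>x $ 1\<bar> + \<bar>x $ 2\<bar>" by (simp add: sum_2)
      also have "\<dots> < 2"
      proof -
        have "0 \<le> x $ 1" "x $ 1 < 1" "0 \<le> x $ 2" "x $ 2 < 1" using that by (auto simp: unit_cube_def)
        then show ?thesis by linarith
      qed
      finally show ?thesis .
    qed
    \<comment> \<open>Small balls around such points miss the cube; large ones have area at least 1,
      while the total integral is below \<open>\<delta> < l\<close>. Hence \<open>G\<close> is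
      nonempty, and \<open>v\<close> will have bounded support.\<close>
    have far: "x \<in> G" if x: "norm x > 4" for x
      unfolding G_def
    proof (intro CollectI allI impI)
      fix r :: real assume r: "r > 0"
      show "I x r \<le> l * (\<omega> * r\<^sup>2)"
      proof (cases "r < 2")
        case True
        have "indicator (cball x r) y *\<^sub>R p y = 0" for y
        proof (cases "y \<in> cball x r")
          case y: True
          then have "norm y \<ge> norm x - r"
            using norm_triangle_sub[of x y] by (auto simp: dist_norm)
          then have "y \<notin> unit_cube" using x True cube_norm[of y] by linarith
          then show ?thesis using p_off by simp
        qed simp
        then have "I x r = 0"
          by (simp only: I_def set_lebesgue_integral_def Bochner_Integration.integral_zero)
        then show ?thesis using l \<omega> by simp
      next
        case False
        have "I x r \<le> l * 1" using I_le[of x r] l by (simp add: \<delta>_def)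
        also have "\<dots> \<le> l * (\<omega> * r\<^sup>2)"
        proof (rule mult_left_mono)
          have "1 \<le> r\<^sup>2" using False by (intro one_le_power) simp
          then have "1 * 1 \<le> \<omega> * r\<^sup>2" using \<omega> by (intro mult_mono) auto
          then show "1 \<le> \<omega> * r\<^sup>2" by simp
        qed (use l in simp)
        finally show ?thesis .
      qed
    qed
    have G_ne: "G \<noteq> {}"
      using far[of "5 *\<^sub>R axis 1 1"] by auto
    \<comment> \<open>Being 1-Lipschitz, this radius changes by at most \<open>h\<close> under a
      shift of length \<open>h\<close>, as \<open>averaged_increment\<close> requires.\<close>
    define \<rho> where "\<rho> x = infdist x G" for x
    have \<rho>_nonneg: "0 \<le> \<rho> x" for x by (simp add: \<rho>_def infdist_nonneg)
    have \<rho>_lip: "\<bar>\<rho> x - \<rho> y\<bar> \<le> norm (x - y)" for x y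
      using infdist_triangle_abs[of x G y] by (simp add: \<rho>_def dist_norm)
    have \<rho>_G: "\<rho> x = 0" if "x \<in> G" for x using that by (simp add: \<rho>_def)
    have G_near: "\<exists>g\<in>G. dist x g < r" if "\<rho> x < r" for x r
      using that G_ne unfolding \<rho>_def infdist_notempty[OF G_ne]
      by (subst (asm) cINF_less_iff) (auto intro: bdd_belowI2[of _ 0])
    have avg: "(LINT y|bump_measure. p (x + \<rho> x *\<^sub>R y)) \<le> \<Lambda>" for x
    proof (cases "\<rho> x = 0")
      case True
      \<comment> \<open>Here \<open>x\<close> is a limit of points of \<open>G\<close>. If
        \<open>p x > \<Lambda>\<close>, the same holds on a small ball about \<open>x\<close>;
        doubling its radius about a nearby point of \<open>G\<close> forces
        \<open>\<Lambda> \<le> 4 * l\<close>, which contradicts \<open>bump_mass_le\<close>.\<close>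
      have "p x \<le> \<Lambda>"
      proof (rule ccontr)
        assume "\<not> p x \<le> \<Lambda>"
        moreover have "open {y. \<Lambda> < p y}"
          by (rule open_Collect_less) (intro continuous_intros cp)+
        ultimately obtain r where r: "r > 0" "cball x r \<subseteq> {y. \<Lambda> < p y}"
          by (auto simp: open_contains_cball not_le)
        obtain g where g: "g \<in> G" "dist x g < r" using G_near[of x r] True r by auto
        have "cball x r \<subseteq> cball g (2 * r)"
        proof
          fix y assume "y \<in> cball x r"
          then show "y \<in> cball g (2 * r)"
            using g dist_triangle[of g y x] by (simp add: dist_commute)
        qed
        then have "I x r \<le> I g (2 * r)" by (rule I_mono)
        also have "\<dots> \<le> l * (\<omega> * (2 * r)\<^sup>2)" using g r by (intro G_D) auto
        finally have le: "I x r \<le> 4 * l * \<omega> * r\<^sup>2" by (simp add: power2_eq_square algebra_simps)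
        have "(LINT y:cball x r|lborel. \<Lambda>) \<le> I x r"
          unfolding I_def
          by (rule set_integral_mono[OF set_integrable_continuous_bounded I_int]) (use r in auto)
        moreover have "(LINT y:cball x r|lborel. \<Lambda>) = \<omega> * r\<^sup>2 * \<Lambda>"
          using r ball_meas[of r x] by (simp add: set_lebesgue_integral_def)
        ultimately have "\<omega> * r\<^sup>2 * \<Lambda> \<le> 4 * l * \<omega> * r\<^sup>2" using le by simp
        then have "(\<omega> * r\<^sup>2) * \<Lambda> \<le> (\<omega> * r\<^sup>2) * (4 * l)" by (simp add: mult_ac)
        then have "\<Lambda> \<le> 4 * l" using \<omega> r by (subst (asm) mult_le_cancel_left_pos) auto
        then have "9 * \<omega> * \<Lambda> \<le> 9 * \<omega> * (4 * l)" using \<omega> by (intro mult_left_mono) auto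
        also have "\<dots> = 4 * (bump_mass * \<Lambda>)" using \<omega> by (simp add: l_def)
        finally have "9 * \<omega> * \<Lambda> \<le> 4 * (bump_mass * \<Lambda>)" .
        then have "9 * \<omega> \<le> 4 * bump_mass" by (simp add: \<Lambda>_def)
        then show False using bump_mass_le \<omega> by (simp add: \<omega>_def)
      qed
      then show ?thesis using True by (simp add: measure_bump_measure_UNIV)
    next
      case False
      then have \<rho>: "\<rho> x > 0" using \<rho>_nonneg[of x] by simp
      have cpx: "continuous_on UNIV (\<lambda>y. p (x + \<rho> x *\<^sub>R y))"
        by (rule continuous_on_compose2[OF cp _ subset_UNIV]) (intro continuous_intros)
      obtain g where g: "g \<in> G" "dist x g < 2 * \<rho> x" using G_near[of x "2 * \<rho> x"] \<rho> by auto
      have sub: "cball x (\<rho> x) \<subseteq> cball g (3 * \<rho> x)"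
      proof
        fix y assume "y \<in> cball x (\<rho> x)"
        then show "y \<in> cball g (3 * \<rho> x)"
          using g dist_triangle[of g y x] by (simp add: dist_commute)
      qed
      have "(LINT y|bump_measure. p (x + \<rho> x *\<^sub>R y)) = (LINT y|lborel. (bump y / bump_mass) * p (x + \<rho> x *\<^sub>R y))"
        by (rule integral_bump_measure[OF borel_measurable_continuous_onI[OF cpx]])
      also have "\<dots> \<le> (LINT y|lborel. (indicator (cball 0 1) y *\<^sub>R p (x + \<rho> x *\<^sub>R y)) / bump_mass)"
      proof (rule integral_mono)
        show "integrable lborel (\<lambda>y. (bump y / bump_mass) * p (x + \<rho> x *\<^sub>R y))"
          using bump_mass_pos
          by (intro integrable_continuous_bounded_support[OF _ bounded_cball[of 0 1]] continuous_intros continuous_bump cpx)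
             (auto simp: bump_off)
        show "integrable lborel (\<lambda>y. (indicator (cball 0 1) y *\<^sub>R p (x + \<rho> x *\<^sub>R y)) / bump_mass)"
          by (intro integrable_divide borel_integrable_compact continuous_on_subset[OF cpx]) auto
        show "(bump y / bump_mass) * p (x + \<rho> x *\<^sub>R y) \<le> (indicator (cball 0 1) y *\<^sub>R p (x + \<rho> x *\<^sub>R y)) / bump_mass" for y
        proof -
          have "bump y * p (x + \<rho> x *\<^sub>R y) \<le> indicator (cball 0 1) y * p (x + \<rho> x *\<^sub>R y)"
            using bump_le_1[of y] bump_off[of y] p_nonneg
            by (intro mult_right_mono) (auto simp: indicator_def)
          then show ?thesis using bump_mass_pos by (simp add: divide_right_mono)
        qed
      qed
      also have "\<dots> = (LINT y|lborel. indicator (cball x (\<rho> x)) (x + \<rho> x *\<^sub>R y) *\<^sub>R p (x + \<rho> x *\<^sub>R y)) / bump_mass"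
      proof -
        have "x + \<rho> x *\<^sub>R y \<in> cball x (\<rho> x) \<longleftrightarrow> y \<in> cball 0 1" for y
          using \<rho> by (simp add: dist_norm)
        then have "indicator (cball x (\<rho> x)) (x + \<rho> x *\<^sub>R y) = (indicator (cball 0 1) y :: real)" for y
          by (simp add: indicator_def)
        then show ?thesis by simp
      qed
      also have "\<dots> = I x (\<rho> x) / (\<rho> x)\<^sup>2 / bump_mass"
      proof -
        have "(\<lambda>y. indicator (cball x (\<rho> x)) y *\<^sub>R p y) \<in> borel_measurable borel"
          by (intro borel_measurable_scaleR borel_measurable_indicator borel_measurable_continuous_onI[OF cp]) auto
        from lborel_integral_affine[OF _ this, of "\<rho> x" x] show ?thesis
          using \<rho> by (simp add: I_def set_lebesgue_integral_def)
      qed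
      also have "\<dots> \<le> (l * (\<omega> * (3 * \<rho> x)\<^sup>2)) / (\<rho> x)\<^sup>2 / bump_mass"
      proof -
        have "I x (\<rho> x) \<le> I g (3 * \<rho> x)" by (rule I_mono[OF sub])
        also have "\<dots> \<le> l * (\<omega> * (3 * \<rho> x)\<^sup>2)" using g \<rho> by (intro G_D) auto
        finally show ?thesis using bump_mass_pos by (intro divide_right_mono) auto
      qed
      also have "\<dots> = 9 * \<omega> * l / bump_mass" using \<rho> by (simp add: power2_eq_square field_simps)
      also have "\<dots> = \<Lambda>" using \<omega> bump_mass_pos by (simp add: l_def)
      finally show ?thesis .
    qed
    have \<Lambda>: "\<Lambda> > 0" by (simp add: \<Lambda>_def)
    obtain d where d: "d > 0"
      "\<And>x v. norm v < d \<Longrightarrow> norm (u (x + v) - u x - jacobian_matrix u x *v v) \<le> \<Lambda> * norm v"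
      using cube_tests_uniform_Taylor[OF u \<Lambda>] by blast
    \<comment> \<open>The bound \<open>d / 3\<close> ensures \<open>2 * h < d\<close> for the
      averaged Taylor estimate; the bound \<open>1 / 2\<close> keeps the shifted functions supported
      in \<open>cball 0 5\<close>.\<close>
    define h where "h = min (d / 3) (1 / 2)"
    have h: "0 < h" "2 * h < d" "h \<le> 1/2" using d by (auto simp: h_def)
    define v where "v i x = (LINT y|bump_measure. u (x + \<rho> x *\<^sub>R y) $ i)" for i x
    have v_G: "v i x = u x $ i" if "x \<in> G" for i x
      using \<rho>_G[OF that] by (simp add: v_def measure_bump_measure_UNIV)
    have v_off: "v i x = 0" if "x \<notin> cball 0 4" for i x
    proof -
      have "x \<in> G" using far[of x] that by simp
      moreover have "x \<notin> unit_cube" using cube_norm[of x] that by auto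
      ultimately show ?thesis using u by (simp add: v_G cube_tests_def)
    qed
    have cu: "continuous_on UNIV u"
      using u C_k_1_has_derivative[of u]
      by (intro continuous_at_imp_continuous_on ballI has_derivative_continuous) (auto simp: cube_tests_def)
    have cu': "continuous_on UNIV (\<lambda>y. u (q + s *\<^sub>R y) $ i)" for q s i
      by (intro continuous_on_component continuous_on_compose2[OF cu _ subset_UNIV] continuous_intros)
    have cv: "continuous_on UNIV (v i)" for i
      unfolding continuous_on_iff
    proof (intro ballI allI impI)
      fix x and e :: real assume e: "e > 0"
      have "uniformly_continuous_on UNIV u"
        using u by (intro uniformly_continuous_bounded_support[OF cu bounded_unit_cube]) (simp add: cube_tests_def)
      then obtain t where t: "t > 0" "\<And>x y. dist y x < t \<Longrightarrow> dist (u y) (u x) < e/2"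
        using e unfolding uniformly_continuous_on_def by (metis UNIV_I half_gt_zero)
      have "dist (v i x') (v i x) < e" if x': "dist x' x < t/2" for x'
      proof -
        have "\<bar>u (x' + \<rho> x' *\<^sub>R y) $ i - u (x + \<rho> x *\<^sub>R y) $ i\<bar> \<le> e/2" if y: "norm y \<le> 1" for y
        proof -
          have "norm ((x' + \<rho> x' *\<^sub>R y) - (x + \<rho> x *\<^sub>R y)) = norm ((x' - x) + (\<rho> x' - \<rho> x) *\<^sub>R y)"
            by (simp add: algebra_simps)
          also have "\<dots> \<le> norm (x' - x) + \<bar>\<rho> x' - \<rho> x\<bar> * norm y"
            using norm_triangle_ineq[of "x' - x" "(\<rho> x' - \<rho> x) *\<^sub>R y"] by simp
          also have "\<dots> \<le> norm (x' - x) + norm (x' - x) * 1"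
            using y \<rho>_lip by (intro add_left_mono mult_mono) auto
          also have "\<dots> < t" using x' by (simp add: dist_norm)
          finally have "dist (u (x' + \<rho> x' *\<^sub>R y)) (u (x + \<rho> x *\<^sub>R y)) < e/2"
            by (intro t(2)) (simp add: dist_norm)
          then show ?thesis
            using component_le_norm_cart[of "u (x' + \<rho> x' *\<^sub>R y) - u (x + \<rho> x *\<^sub>R y)" i] by (simp add: dist_norm)
        qed
        note le = this
        have "\<bar>v i x' - v i x\<bar> = \<bar>LINT y|bump_measure. u (x' + \<rho> x' *\<^sub>R y) $ i - u (x + \<rho> x *\<^sub>R y) $ i\<bar>"
          unfolding v_def by (subst Bochner_Integration.integral_diff) (intro bump_measure_integrable cu' refl)+
        also have "\<dots> \<le> (LINT y|bump_measure. \<bar>u (x' + \<rho> x' *\<^sub>R y) $ i - u (x + \<rho> x *\<^sub>R y) $ i\<bar>)"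
          by (rule integral_abs_bound)
        also have "\<dots> \<le> (LINT y|bump_measure. e/2)"
          by (rule bump_measure_integral_mono[OF _ _ le]) (intro continuous_intros cu')+
        also have "\<dots> = e/2" by (simp add: measure_bump_measure_UNIV)
        finally show ?thesis using e by (simp add: dist_real_def)
      qed
      then show "\<exists>t>0. \<forall>x'\<in>UNIV. dist x' x < t \<longrightarrow> dist (v i x') (v i x) < e"
        using t(1) by (intro exI[of _ "t/2"]) auto
    qed
    define J where "J i j x = (LINT y|bump_measure. jacobian_matrix u (x + \<rho> x *\<^sub>R y) $ i $ j)" for i j x
    have incr: "\<bar>v i (x + h *\<^sub>R axis j 1) - v i x - h * J i j x\<bar> \<le> 3 * h * \<Lambda>" for i j x
    proof -
      have "\<bar>\<rho> (x + h *\<^sub>R axis j 1) - \<rho> x\<bar> \<le> h"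
        using \<rho>_lip[of "x + h *\<^sub>R axis j 1" x] h by simp
      from averaged_increment[OF u less_imp_le[OF \<Lambda>] d(2) less_imp_le[OF h(1)] h(2) this, where x = x and i = i]
      have "\<bar>v i (x + h *\<^sub>R axis j 1) - v i x - h * J i j x\<bar> \<le>
          h * (LINT y|bump_measure. p (x + \<rho> x *\<^sub>R y)) + 2 * \<Lambda> * h"
        by (simp add: v_def J_def p_def)
      also have "\<dots> \<le> h * \<Lambda> + 2 * \<Lambda> * h" using avg[of x] h by simp
      finally show ?thesis by (simp add: algebra_simps)
    qed
    have J_bound: "\<bar>J 1 1 x - J 2 2 x\<bar> \<le> \<Lambda>" "\<bar>J 1 2 x\<bar> \<le> \<Lambda>" "\<bar>J 2 1 x\<bar> \<le> \<Lambda>" for x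
    proof -
      note cJ = cube_tests_continuous_jacobian[OF u, of x "\<rho> x"]
      have *: "\<bar>integral\<^sup>L bump_measure f\<bar> \<le> \<Lambda>"
        if "continuous_on UNIV f" "\<And>y. \<bar>f y\<bar> \<le> p (x + \<rho> x *\<^sub>R y)" for f
      proof -
        have "\<bar>integral\<^sup>L bump_measure f\<bar> \<le> (LINT y|bump_measure. \<bar>f y\<bar>)" by (rule integral_abs_bound)
        also have "\<dots> \<le> (LINT y|bump_measure. p (x + \<rho> x *\<^sub>R y))"
          by (rule bump_measure_integral_mono)
             (intro continuous_intros that continuous_on_compose2[OF cp _ subset_UNIV])+
        finally show ?thesis using avg[of x] by simp
      qed
      show "\<bar>J 1 2 x\<bar> \<le> \<Lambda>" "\<bar>J 2 1 x\<bar> \<le> \<Lambda>"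
        unfolding J_def by (intro * cJ; simp add: p_def scalar_defect_def)+
      have "J 1 1 x - J 2 2 x = (LINT y|bump_measure. jacobian_matrix u (x + \<rho> x *\<^sub>R y) $ 1 $ 1 - jacobian_matrix u (x + \<rho> x *\<^sub>R y) $ 2 $ 2)"
        unfolding J_def by (subst Bochner_Integration.integral_diff) (intro bump_measure_integrable cJ refl)+
      then show "\<bar>J 1 1 x - J 2 2 x\<bar> \<le> \<Lambda>"
        using *[of "\<lambda>y. jacobian_matrix u (x + \<rho> x *\<^sub>R y) $ 1 $ 1 - jacobian_matrix u (x + \<rho> x *\<^sub>R y) $ 2 $ 2"]
        by (simp add: cJ continuous_on_diff p_def scalar_defect_def)
    qed
    define s t where "s = h *\<^sub>R (axis 1 1 :: real^2)" and "t = h *\<^sub>R (axis 2 1 :: real^2)"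
    \<comment> \<open>Each increment differs from \<open>h * J\<close> by at most
      \<open>3 * h * \<Lambda>\<close>; two increments and one \<open>J\<close> bound make 7, and
      this also covers the off-diagonal cases.\<close>
    have \<Delta>: "\<bar>(v 1 (x + s) - v 1 x) - (v 2 (x + t) - v 2 x)\<bar> \<le> 7 * h * \<Lambda>"
      "\<bar>v 1 (x + t) - v 1 x\<bar> \<le> 7 * h * \<Lambda>" "\<bar>v 2 (x + s) - v 2 x\<bar> \<le> 7 * h * \<Lambda>" for x
    proof -
      have "h * \<bar>J 1 1 x - J 2 2 x\<bar> \<le> h * \<Lambda>" "h * \<bar>J 1 2 x\<bar> \<le> h * \<Lambda>" "h * \<bar>J 2 1 x\<bar> \<le> h * \<Lambda>"
        using h J_bound[of x] by (auto intro: mult_left_mono)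
      then have "\<bar>h * J 1 1 x - h * J 2 2 x\<bar> \<le> h * \<Lambda>" "\<bar>h * J 1 2 x\<bar> \<le> h * \<Lambda>" "\<bar>h * J 2 1 x\<bar> \<le> h * \<Lambda>"
        using h by (auto simp: abs_mult right_diff_distrib[symmetric])
      moreover have "0 \<le> h * \<Lambda>" using h \<Lambda> by simp
      ultimately show "\<bar>(v 1 (x + s) - v 1 x) - (v 2 (x + t) - v 2 x)\<bar> \<le> 7 * h * \<Lambda>"
        "\<bar>v 1 (x + t) - v 1 x\<bar> \<le> 7 * h * \<Lambda>" "\<bar>v 2 (x + s) - v 2 x\<bar> \<le> 7 * h * \<Lambda>"
        using incr[of 1 x 1] incr[of 2 x 2] incr[of 1 x 2] incr[of 2 x 1] by (auto simp: s_def t_def)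
    qed
    have st: "norm s \<le> 1" "norm t \<le> 1" using h by (auto simp: s_def t_def)
    have off: "v i x = 0" "v i (x + s) = 0" "v i (x + t) = 0" if "x \<notin> cball 0 5" for i x
    proof -
      have "norm x > 5" using that by simp
      then have "x \<notin> cball 0 4" "x + s \<notin> cball 0 4" "x + t \<notin> cball 0 4"
        using st norm_diff_ineq[of x s] norm_diff_ineq[of x t] by auto
      then show "v i x = 0" "v i (x + s) = 0" "v i (x + t) = 0" by (auto intro: v_off)
    qed
    have cshift: "continuous_on UNIV (\<lambda>x. v i (x + r))" for i r
      by (rule continuous_on_compose2[OF cv _ subset_UNIV]) (intro continuous_intros)
    have sq: "(LINT x|lborel. (f x)\<^sup>2) \<le> (7 * h * \<Lambda>)\<^sup>2 * (25 * \<omega>)"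
      if f: "continuous_on UNIV f" "\<And>x. \<bar>f x\<bar> \<le> 7 * h * \<Lambda>" "\<And>x. x \<notin> cball 0 5 \<Longrightarrow> f x = 0" for f :: "real^2 \<Rightarrow> real"
    proof -
      have "(LINT x|lborel. (f x)\<^sup>2) \<le> (LINT x|lborel. (7 * h * \<Lambda>)\<^sup>2 * indicator (cball (0::real^2) 5) x)"
      proof (rule integral_mono)
        show "integrable lborel (\<lambda>x. (f x)\<^sup>2)"
          by (rule integrable_continuous_bounded_support[OF _ bounded_cball[of 0 5]]) (auto intro!: continuous_intros f)
        show "integrable lborel (\<lambda>x. (7 * h * \<Lambda>)\<^sup>2 * indicator (cball (0::real^2) 5) x)"
          using emeasure_bounded_finite[OF bounded_cball, of "0::real^2" 5]
          by (intro integrable_mult_right integrable_real_indicator) auto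
        show "(f x)\<^sup>2 \<le> (7 * h * \<Lambda>)\<^sup>2 * indicator (cball 0 5) x" for x
        proof (cases "x \<in> cball 0 5")
          case True
          have "\<bar>f x\<bar>\<^sup>2 \<le> (7 * h * \<Lambda>)\<^sup>2" by (intro power_mono f) auto
          then show ?thesis using True by simp
        qed (simp add: f(3))
      qed
      also have "\<dots> = (7 * h * \<Lambda>)\<^sup>2 * (25 * \<omega>)" using ball_meas[of 5 0] by simp
      finally show ?thesis .
    qed
    have "(LINT x|lborel. (v 1 (x + s) - v 1 x)\<^sup>2) \<le>
      (LINT x|lborel. ((v 1 (x + s) - v 1 x) - (v 2 (x + t) - v 2 x))\<^sup>2) +
      (LINT x|lborel. (v 1 (x + t) - v 1 x)\<^sup>2) + (LINT x|lborel. (v 2 (x + s) - v 2 x)\<^sup>2)"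
      by (rule discrete_Korn[OF cv v_off cv v_off bounded_cball])
    also have "\<dots> \<le> (7 * h * \<Lambda>)\<^sup>2 * (25 * \<omega>) + (7 * h * \<Lambda>)\<^sup>2 * (25 * \<omega>) + (7 * h * \<Lambda>)\<^sup>2 * (25 * \<omega>)"
      by (intro add_mono sq \<Delta>) (auto intro!: continuous_intros cshift cv simp: off)
    also have "\<dots> \<le> h\<^sup>2 / 256"
    proof -
      have "3 * ((7 * h * \<Lambda>)\<^sup>2 * (25 * \<omega>)) \<le> 3 * ((7 * h * \<Lambda>)\<^sup>2 * 100)"
        using \<omega> by (intro mult_left_mono) auto
      also have "\<dots> = h\<^sup>2 * (14700 * \<Lambda>\<^sup>2)" by (simp add: power_mult_distrib)
      also have "\<dots> \<le> h\<^sup>2 * (1 / 256)" by (intro mult_left_mono) (auto simp: \<Lambda>_def power2_eq_square)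
      finally show ?thesis by (simp add: mult_ac)
    qed
    finally have L2: "(LINT x|lborel. (v 1 (x + s) - v 1 x)\<^sup>2) \<le> h\<^sup>2 / 256" .
    \<comment> \<open>Chebyshev at the level \<open>(h / 8)\<^sup>2\<close>, against the L^2 bound
      \<open>h\<^sup>2 / 256\<close>, leaves measure at most 1/4.\<close>
    define W where "W = {x. h\<^sup>2 / 64 \<le> (v 1 (x + s) - v 1 x)\<^sup>2}"
    have W_small: "measure lborel W \<le> 1/4"
    proof -
      have "measure lborel {x \<in> space lborel. h\<^sup>2 / 64 \<le> (v 1 (x + s) - v 1 x)\<^sup>2} \<le> (LINT x|lborel. (v 1 (x + s) - v 1 x)\<^sup>2) / (h\<^sup>2 / 64)"
        using h
        by (intro integral_Markov_inequality_measure[where A = "{}"] integrable_continuous_bounded_support[OF _ bounded_cball[of 0 5]])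
           (auto intro!: continuous_intros cshift cv simp: off)
      also have "\<dots> \<le> (h\<^sup>2 / 256) / (h\<^sup>2 / 64)" by (intro divide_right_mono L2) simp
      also have "\<dots> = 1/4" using h by simp
      finally show ?thesis by (simp add: W_def)
    qed
    have W_fm: "W \<in> fmeasurable lborel"
    proof (rule fmeasurableI)
      have "closed W" unfolding W_def
        by (intro closed_Collect_le continuous_intros cshift cv)
      then show "W \<in> sets lborel" by auto
      have "W \<subseteq> cball 0 5"
      proof
        fix x assume "x \<in> W"
        then show "x \<in> cball 0 5" using off[of x 1] h by (cases "x \<in> cball 0 5") (auto simp: W_def)
      qed
      then show "emeasure lborel W < \<infinity>" by (intro emeasure_bounded_finite bounded_subset[OF bounded_cball])
    qed
    \<comment> \<open>The increments of \<open>v\<close> and \<open>u\<close> agree only where both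
      \<open>x\<close> and \<open>x + s\<close> lie in \<open>G\<close>, so the shifted copy of
      \<open>U\<close> is removed as well.\<close>
    define U' where "U' = {x. x + s \<in> U}"
    have U_borel: "U \<in> sets borel" using U(1) by (auto dest: fmeasurableD)
    note U' = emeasure_translation_vimage[OF U_borel, of s, folded U'_def]
    have U'_fm: "U' \<in> fmeasurable lborel" using U(1) U' by (auto simp: fmeasurable_def)
    have U'_small: "measure lborel U' \<le> 1/8" using U_small U'(2) by (simp add: measure_def)
    define B where "B = U \<union> U' \<union> W"
    have B_fm: "B \<in> fmeasurable lborel" unfolding B_def by (intro fmeasurable.Un U(1) U'_fm W_fm)
    have "measure lborel B \<le> measure lborel (U \<union> U') + measure lborel W"
      unfolding B_def by (rule measure_Un_le) (use fmeasurable.Un[OF U(1) U'_fm] W_fm in \<open>auto dest: fmeasurableD\<close>)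
    also have "measure lborel (U \<union> U') \<le> measure lborel U + measure lborel U'"
      by (rule measure_Un_le) (use U(1) U'_fm in \<open>auto dest: fmeasurableD\<close>)
    finally have B_small: "measure lborel B \<le> 1/2" using U_small U'_small W_small by linarith
    have cube_fm: "unit_cube \<in> fmeasurable (lborel :: (real^2) measure)"
      using emeasure_bounded_finite[OF bounded_unit_cube] by (intro fmeasurableI) auto
    show "\<exists>E\<in>sets borel. E \<subseteq> unit_cube \<and> 1/2 \<le> measure lborel E \<and> (\<forall>x\<in>E. \<bar>jacobian_matrix u x $ 1 $ 1\<bar> \<le> 1/4)"
    proof (intro bexI[of _ "unit_cube - B"] conjI ballI)
      show "unit_cube - B \<in> sets borel" using B_fm by (auto dest: fmeasurableD)
      have "measure lborel (unit_cube :: (real^2) set) - measure lborel B \<le> measure lborel (unit_cube - B)"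
        by (rule measure_diff_le_measure_setdiff[OF cube_fm B_fm])
      then show "1/2 \<le> measure lborel (unit_cube - B)" using B_small by (simp add: measure_unit_cube)
      fix x assume x: "x \<in> unit_cube - B"
      then have "x \<in> G" "x + s \<in> G" by (auto simp: B_def U'_def intro!: G_U)
      then have "(u (x + s) $ 1 - u x $ 1)\<^sup>2 < (h / 8)\<^sup>2"
        using x by (simp add: B_def W_def v_G power_divide)
      then have 1: "\<bar>u (x + s) $ 1 - u x $ 1\<bar> < h / 8"
        using h by (intro power2_less_imp_less[of "\<bar>u (x + s) $ 1 - u x $ 1\<bar>"]) auto
      have "norm s = h" using h by (simp add: s_def)
      then have "norm (u (x + s) - u x - jacobian_matrix u x *v s) \<le> \<Lambda> * h"
        using d(2)[of s x] h by simp
      then have "\<bar>(u (x + s) - u x - jacobian_matrix u x *v s) $ 1\<bar> \<le> \<Lambda> * h"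
        by (rule order_trans[OF component_le_norm_cart])
      moreover have "(jacobian_matrix u x *v s) $ 1 = h * jacobian_matrix u x $ 1 $ 1"
        by (simp add: matrix_vector_mult_2 s_def axis_def)
      ultimately have "\<bar>u (x + s) $ 1 - u x $ 1 - h * jacobian_matrix u x $ 1 $ 1\<bar> \<le> \<Lambda> * h" by simp
      \<comment> \<open>One \<open>h / 8\<close> comes from avoiding \<open>W\<close>, the other
        from the Taylor remainder; together they make the factor 1/4.\<close>
      moreover have "\<Lambda> * h \<le> h / 8" using h by (simp add: \<Lambda>_def)
      ultimately have "\<bar>h * jacobian_matrix u x $ 1 $ 1\<bar> \<le> h * (1/4)" using 1 by linarith
      then show "\<bar>jacobian_matrix u x $ 1 $ 1\<bar> \<le> 1/4" using h by (simp add: abs_mult)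
    qed auto
  qed
qed

section \<open>The separated family\<close>

lemma scaleR_in_cube_tests:
  fixes \<phi> :: "real^'n \<Rightarrow> real^'m"
  assumes "\<phi> \<in> cube_tests"
  shows "(\<lambda>x. c *\<^sub>R \<phi> x) \<in> cube_tests"
    "jacobian_matrix (\<lambda>x. c *\<^sub>R \<phi> x) = (\<lambda>x. c *\<^sub>R jacobian_matrix \<phi> x)"
proof -
  have \<phi>: "C_k (Suc 0) \<phi>" using assms by (simp add: cube_tests_def)
  have d: "((\<lambda>x. c *\<^sub>R \<phi> x) has_derivative ((*v) (c *\<^sub>R jacobian_matrix \<phi> x))) (at x)" for x
    using has_derivative_scaleR_right[OF C_k_1_has_derivative[OF \<phi>], of c]
    by (simp add: scaleR_matrix_vector_assoc)
  have c: "continuous_on UNIV (\<lambda>x. c *\<^sub>R jacobian_matrix \<phi> x)"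
    using \<phi> by (intro continuous_intros) (simp add: C_k_1_iff)
  show "(\<lambda>x. c *\<^sub>R \<phi> x) \<in> cube_tests"
    "jacobian_matrix (\<lambda>x. c *\<^sub>R \<phi> x) = (\<lambda>x. c *\<^sub>R jacobian_matrix \<phi> x)"
    using C_k_1_I[OF d c] assms by (auto simp: cube_tests_def)
qed

lemma scalar_defect_mat: "scalar_defect (mat s + A) = scalar_defect A"
  by (simp add: scalar_defect_def mat_def)

lemma scalar_defect_scaleR: "0 \<le> c \<Longrightarrow> scalar_defect (c *\<^sub>R A) = c * scalar_defect A"
  by (simp add: scalar_defect_def abs_mult distrib_left flip: right_diff_distrib)

lemma matrix_component_le_norm: "\<bar>A $ i $ j\<bar> \<le> norm (A :: real^'n^'m)"
  using component_le_norm_cart[of "A $ i" j] Finite_Cartesian_Product.norm_nth_le[of A i] by linarith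

lemma scalar_defect_lipschitz: "\<bar>scalar_defect A - scalar_defect B\<bar> \<le> 4 * norm (A - B)"
proof -
  have c: "\<bar>A $ i $ j - B $ i $ j\<bar> \<le> norm (A - B)" for i j
    using matrix_component_le_norm[of "A - B" i j] by simp
  have 1: "\<bar>\<bar>A $ 1 $ 1 - A $ 2 $ 2\<bar> - \<bar>B $ 1 $ 1 - B $ 2 $ 2\<bar>\<bar> \<le> 2 * norm (A - B)"
    using c[of 1 1] c[of 2 2] by linarith
  have 2: "\<bar>\<bar>A $ i $ j\<bar> - \<bar>B $ i $ j\<bar>\<bar> \<le> norm (A - B)" for i j
    using c[of i j] by linarith
  show ?thesis
    using 1 2[of 1 2] 2[of 2 1] unfolding scalar_defect_def abs_le_iff by linarith
qed

lemma continuous_scalar_defect: "continuous_on UNIV scalar_defect"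
  unfolding scalar_defect_def by (intro continuous_intros)

text \<open>With \<open>C = 1 / \<delta>\<close>, either the defect integral reaches
  \<open>\<delta>\<close> and the first summand alone contributes 1, or the weak-type inequality
  makes the second summand at least 1/4 on a set of measure 1/2. This is the lower bound at scale
  one.\<close>

lemma bump_integral_bound:
  "\<exists>C>0. \<forall>u \<in> cube_tests :: (real^2 \<Rightarrow> real^2) set. 1/8 \<le> (LINT x:unit_cube|lborel.
    C * scalar_defect (jacobian_matrix u x) + max 0 (1/2 - \<bar>jacobian_matrix u x $ 1 $ 1\<bar>))"
proof -
  obtain \<delta> where \<delta>: "\<delta> > 0" and E: "\<And>u :: real^2 \<Rightarrow> real^2. u \<in> cube_tests \<Longrightarrow>
      (LINT x:unit_cube|lborel. scalar_defect (jacobian_matrix u x)) < \<delta> \<Longrightarrow>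
      \<exists>E\<in>sets borel. E \<subseteq> unit_cube \<and> 1/2 \<le> measure lborel E \<and> (\<forall>x\<in>E. \<bar>jacobian_matrix u x $ 1 $ 1\<bar> \<le> 1/4)"
    using scalar_defect_controls_trace by metis
  show ?thesis
  proof (intro exI[of _ "1 / \<delta>"] conjI ballI)
    fix u :: "real^2 \<Rightarrow> real^2" assume u: "u \<in> cube_tests"
    have cJ: "continuous_on UNIV (jacobian_matrix u)" using u by (simp add: cube_tests_def C_k_1_iff)
    have c1: "continuous_on UNIV (\<lambda>x. 1 / \<delta> * scalar_defect (jacobian_matrix u x))"
      by (intro continuous_intros continuous_on_compose2[OF continuous_scalar_defect cJ]) auto
    have c2: "continuous_on UNIV (\<lambda>x. max 0 (1/2 - \<bar>jacobian_matrix u x $ 1 $ 1\<bar>))"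
      by (intro continuous_intros cJ)
    note int = set_integrable_continuous_bounded[OF _ unit_cube_borel bounded_unit_cube]
    have split: "(LINT x:unit_cube|lborel. 1 / \<delta> * scalar_defect (jacobian_matrix u x) + max 0 (1/2 - \<bar>jacobian_matrix u x $ 1 $ 1\<bar>)) =
      (LINT x:unit_cube|lborel. 1 / \<delta> * scalar_defect (jacobian_matrix u x)) +
      (LINT x:unit_cube|lborel. max 0 (1/2 - \<bar>jacobian_matrix u x $ 1 $ 1\<bar>))"
      by (rule set_integral_add(2)[OF int[OF c1] int[OF c2]])
    have n1: "0 \<le> (LINT x:unit_cube|lborel. 1 / \<delta> * scalar_defect (jacobian_matrix u x))"
      "0 \<le> (LINT x:unit_cube|lborel. max 0 (1/2 - \<bar>jacobian_matrix u x $ 1 $ 1\<bar>))"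
      unfolding set_lebesgue_integral_def using \<delta> by (auto intro!: integral_nonneg_AE simp: scalar_defect_nonneg)
    show "1/8 \<le> (LINT x:unit_cube|lborel. 1 / \<delta> * scalar_defect (jacobian_matrix u x) + max 0 (1/2 - \<bar>jacobian_matrix u x $ 1 $ 1\<bar>))"
    proof (cases "(LINT x:unit_cube|lborel. scalar_defect (jacobian_matrix u x)) < \<delta>")
      case False
      then have "1 \<le> 1 / \<delta> * (LINT x:unit_cube|lborel. scalar_defect (jacobian_matrix u x))"
        using \<delta> by (simp add: field_simps)
      also have "\<dots> = (LINT x:unit_cube|lborel. 1 / \<delta> * scalar_defect (jacobian_matrix u x))" by simp
      finally show ?thesis using n1 split by linarith
    next
      case True
      then obtain E where E: "E \<in> sets borel" "E \<subseteq> unit_cube" "1/2 \<le> measure lborel E"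
          "\<And>x. x \<in> E \<Longrightarrow> \<bar>jacobian_matrix u x $ 1 $ 1\<bar> \<le> 1/4"
        using E[OF u] by blast
      have "emeasure lborel E < \<infinity>"
        by (rule emeasure_bounded_finite[OF bounded_subset[OF bounded_unit_cube E(2)]])
      then have iE: "integrable lborel (\<lambda>x. indicator E x *\<^sub>R (1/4 :: real))"
        using E(1) by (intro integrable_scaleR_left integrable_real_indicator) auto
      have "1/8 \<le> (LINT x|lborel. indicator E x *\<^sub>R (1/4 :: real))" using E(3) by simp
      also have "\<dots> \<le> (LINT x:unit_cube|lborel. max 0 (1/2 - \<bar>jacobian_matrix u x $ 1 $ 1\<bar>))"
        unfolding set_lebesgue_integral_def
      proof (rule integral_mono[OF iE int[OF c2, unfolded set_integrable_def]])
        show "indicator E x *\<^sub>R (1/4) \<le> indicator unit_cube x *\<^sub>R max 0 (1/2 - \<bar>jacobian_matrix u x $ 1 $ 1\<bar>)" for x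
          using E(2) E(4)[of x] by (auto simp: indicator_def)
      qed
      finally show ?thesis using n1 split by linarith
    qed
  qed (use \<delta> in simp)
qed

text \<open>Powers of 2 keep each omitted point \<open>2 ^ k\<close> at a distance from the set
  proportional to its size, which survives division by \<open>1 + norm z\<close>. The point 0 keeps
  the set nonempty for every \<open>A\<close> and makes \<open>gap_integrand\<close> vanish at the
  origin.\<close>

definition dyadic_gaps :: "nat set \<Rightarrow> real set" where
  "dyadic_gaps A = insert 0 ((\<lambda>k. 2 ^ k) ` (- A))"

text \<open>Both 0 and all other powers of 2 are at distance at least \<open>2 ^ k / 2\<close> from
  \<open>2 ^ k\<close>, and the distance to a set is 1-Lipschitz.\<close>

lemma infdist_dyadic_gaps_ge:
  assumes k: "k \<in> A"
  shows "2 ^ k * max 0 (1/2 - \<bar>a\<bar>) \<le> infdist (2 ^ k + 2 ^ k * a) (dyadic_gaps A)"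
proof -
  have "2 ^ k / 2 \<le> dist (2 ^ k) b" if "b \<in> dyadic_gaps A" for b :: real
    using that unfolding dyadic_gaps_def
  proof (elim insertE imageE)
    fix j assume b: "b = 2 ^ j" and "j \<in> - A"
    then have "j \<noteq> k" using k by auto
    then consider "Suc j \<le> k" | "Suc k \<le> j" by linarith
    then show ?thesis
    proof cases
      case 1
      then have "(2::real) ^ Suc j \<le> 2 ^ k" by (intro power_increasing) auto
      then show ?thesis using abs_ge_self[of "2 ^ k - 2 ^ j :: real"] by (simp add: b dist_real_def)
    next
      case 2
      then have "(2::real) ^ Suc k \<le> 2 ^ j" by (intro power_increasing) auto
      then show ?thesis using abs_ge_minus_self[of "2 ^ k - 2 ^ j :: real"] zero_less_power[of "2::real" k]
        unfolding b dist_real_def power_Suc by linarith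
    qed
  qed simp
  moreover have ne: "dyadic_gaps A \<noteq> {}" by (simp add: dyadic_gaps_def)
  ultimately have "2 ^ k / 2 \<le> infdist (2 ^ k) (dyadic_gaps A)"
    unfolding infdist_notempty[OF ne] by (intro cINF_greatest) auto
  also have "\<dots> \<le> infdist (2 ^ k + 2 ^ k * a) (dyadic_gaps A) + dist (2 ^ k) (2 ^ k + 2 ^ k * a)"
    by (rule infdist_triangle)
  also have "dist (2 ^ k) (2 ^ k + 2 ^ k * a) = 2 ^ k * \<bar>a\<bar>" by (simp add: dist_real_def abs_mult)
  finally have "2 ^ k * (1/2 - \<bar>a\<bar>) \<le> infdist (2 ^ k + 2 ^ k * a) (dyadic_gaps A)"
    by (simp add: algebra_simps)
  then show ?thesis
    by (simp add: max_def infdist_nonneg)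
qed

definition gap_integrand :: "real \<Rightarrow> nat set \<Rightarrow> real^2^2 \<Rightarrow> real" where
  "gap_integrand C A z = C * scalar_defect z + infdist (z $ 1 $ 1) (dyadic_gaps A)"

lemma gap_integrand_lipschitz: "0 \<le> C \<Longrightarrow> lipschitz_integrand (gap_integrand C A) (4 * C + 1)"
proof
  assume C: "0 \<le> C"
  fix z w :: "real^2^2"
  have "\<bar>infdist (z $ 1 $ 1) (dyadic_gaps A) - infdist (w $ 1 $ 1) (dyadic_gaps A)\<bar> \<le> norm (z - w)"
    using infdist_triangle_abs[of "z $ 1 $ 1" "dyadic_gaps A" "w $ 1 $ 1"] matrix_component_le_norm[of "z - w" 1 1]
    by (simp add: dist_real_def)
  moreover have "\<bar>C * scalar_defect z - C * scalar_defect w\<bar> \<le> C * (4 * norm (z - w))"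
    using mult_left_mono[OF scalar_defect_lipschitz[of z w] C] C by (simp add: abs_mult flip: right_diff_distrib)
  ultimately show "\<bar>gap_integrand C A z - gap_integrand C A w\<bar> \<le> (4 * C + 1) * norm (z - w)"
    unfolding gap_integrand_def by (simp add: algebra_simps)
  show "0 \<le> gap_integrand C A z"
    using C by (simp add: gap_integrand_def scalar_defect_nonneg infdist_nonneg)
qed

lemma envelope_gap_integrand_in_space:
  assumes C: "0 \<le> C"
  shows "envelope (gap_integrand C A) \<in> quasi_convex_linear_growth"
proof -
  interpret lipschitz_integrand "gap_integrand C A" "4 * C + 1" by (rule gap_integrand_lipschitz[OF C])
  have "\<bar>envelope (gap_integrand C A) z\<bar> \<le> (4 * C + 1) * (1 + norm z)" for z
  proof -
    have "gap_integrand C A 0 = 0"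
      by (simp add: gap_integrand_def scalar_defect_def dyadic_gaps_def)
    then have "gap_integrand C A z \<le> (4 * C + 1) * norm z" using lipschitz[of z 0] by simp
    also have "\<dots> \<le> (4 * C + 1) * (1 + norm z)" using C by (intro mult_left_mono) auto
    finally show ?thesis using envelope_le_self[of z] envelope_nonneg[of z] by linarith
  qed
  then have "linear_growth (envelope (gap_integrand C A))"
    unfolding linear_growth_def using C by (intro exI[of _ "4 * C + 1"]) auto
  then show ?thesis by (simp add: quasi_convex_linear_growth_def quasi_convex_envelope)
qed

lemma envelope_gap_integrand_eq_0:
  assumes C: "0 \<le> C" and k: "k \<notin> A"
  shows "envelope (gap_integrand C A) (mat (2 ^ k)) = 0"
proof -
  interpret lipschitz_integrand "gap_integrand C A" "4 * C + 1" by (rule gap_integrand_lipschitz[OF C])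
  have "gap_integrand C A (mat (2 ^ k)) = 0"
    using k scalar_defect_mat[of "2 ^ k" 0]
    by (simp add: gap_integrand_def dyadic_gaps_def mat_def scalar_defect_def)
  then show ?thesis using envelope_le_self[of "mat (2 ^ k)"] envelope_nonneg[of "mat (2 ^ k)"] by linarith
qed

text \<open>Dividing the test function by \<open>2 ^ k\<close> reduces the claim to scale one by
  homogeneity, and adding \<open>mat (2 ^ k)\<close> does not change the scalar defect. So a single
  \<open>C\<close> serves for all \<open>k\<close>.\<close>

lemma envelope_gap_integrand_ge:
  assumes C: "0 \<le> C" and k: "k \<in> A"
    and bound: "\<And>u :: real^2 \<Rightarrow> real^2. u \<in> cube_tests \<Longrightarrow>
    1/8 \<le> (LINT x:unit_cube|lborel. C * scalar_defect (jacobian_matrix u x) + max 0 (1/2 - \<bar>jacobian_matrix u x $ 1 $ 1\<bar>))"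
  shows "2 ^ k / 8 \<le> envelope (gap_integrand C A) (mat (2 ^ k))"
proof -
  interpret lipschitz_integrand "gap_integrand C A" "4 * C + 1" by (rule gap_integrand_lipschitz[OF C])
  show ?thesis
  proof (rule envelope_ge)
    fix \<phi> :: "real^2 \<Rightarrow> real^2" assume \<phi>: "\<phi> \<in> cube_tests"
    define s :: real where "s = 2 ^ k"
    have s: "s > 0" by (simp add: s_def)
    define u where "u x = (1 / s) *\<^sub>R \<phi> x" for x
    have u: "u \<in> cube_tests" and Ju: "jacobian_matrix u x = (1 / s) *\<^sub>R jacobian_matrix \<phi> x" for x
      using scaleR_in_cube_tests[OF \<phi>, of "1 / s"] by (auto simp: u_def[abs_def])
    have J\<phi>: "jacobian_matrix \<phi> x = s *\<^sub>R jacobian_matrix u x" for x using s by (simp add: Ju)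
    have C\<phi>: "C_k (Suc 0) \<phi>" using \<phi> by (simp add: cube_tests_def)
    have cJ: "continuous_on UNIV (jacobian_matrix u)" using u by (simp add: cube_tests_def C_k_1_iff)
    have cu: "continuous_on UNIV (\<lambda>x. s * (C * scalar_defect (jacobian_matrix u x) + max 0 (1/2 - \<bar>jacobian_matrix u x $ 1 $ 1\<bar>)))"
      by (intro continuous_intros cJ continuous_on_compose2[OF continuous_scalar_defect cJ]) auto
    have "2 ^ k / 8 = s * (1 / 8)" by (simp add: s_def)
    also have "\<dots> \<le> s * (LINT x:unit_cube|lborel. C * scalar_defect (jacobian_matrix u x) + max 0 (1/2 - \<bar>jacobian_matrix u x $ 1 $ 1\<bar>))"
      using s bound[OF u] by (intro mult_left_mono) auto
    also have "\<dots> = (LINT x:unit_cube|lborel. s * (C * scalar_defect (jacobian_matrix u x) + max 0 (1/2 - \<bar>jacobian_matrix u x $ 1 $ 1\<bar>)))"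
      by (rule set_integral_mult_right[symmetric])
    also have "\<dots> \<le> (LINT x:unit_cube|lborel. gap_integrand C A (mat (2 ^ k) + jacobian_matrix \<phi> x))"
    proof (rule set_integral_mono)
      show "set_integrable lborel unit_cube (\<lambda>x. s * (C * scalar_defect (jacobian_matrix u x) + max 0 (1/2 - \<bar>jacobian_matrix u x $ 1 $ 1\<bar>)))"
        by (rule set_integrable_continuous_bounded[OF cu unit_cube_borel bounded_unit_cube])
      show "set_integrable lborel unit_cube (\<lambda>x. gap_integrand C A (mat (2 ^ k) + jacobian_matrix \<phi> x))"
        by (rule integrand_integrable[OF C\<phi> unit_cube_borel bounded_unit_cube])
      fix x
      show "s * (C * scalar_defect (jacobian_matrix u x) + max 0 (1/2 - \<bar>jacobian_matrix u x $ 1 $ 1\<bar>))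
        \<le> gap_integrand C A (mat (2 ^ k) + jacobian_matrix \<phi> x)"
        unfolding gap_integrand_def scalar_defect_mat J\<phi>
        using infdist_dyadic_gaps_ge[OF k, of "jacobian_matrix u x $ 1 $ 1", folded s_def] s
        by (simp add: scalar_defect_scaleR mat_def distrib_left mult.left_commute s_def[symmetric])
    qed
    finally show "2 ^ k / 8 \<le> (LINT x:unit_cube|lborel. gap_integrand C A (mat (2 ^ k) + jacobian_matrix \<phi> x))" .
  qed
qed

section \<open>Uniform separation and non-separability\<close>

lemma T_dist_ge:
  fixes f g :: "real^'n^'m \<Rightarrow> real"
  assumes "linear_growth f" "linear_growth g"
  shows "\<bar>f w - g w\<bar> / (1 + norm w) \<le> T_dist f g"
proof -
  \<comment> \<open>\<open>z\<close> inverts the radial rescaling in \<open>T\<close>: it is sent to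
    \<open>w\<close>, and the factor \<open>1 - norm z\<close> equals
    \<open>1 / (1 + norm w)\<close>.\<close>
  define z where "z = w /\<^sub>R (1 + norm w)"
  have p: "1 + norm w > 0" by (simp add: add_pos_nonneg)
  have nz: "norm z = norm w / (1 + norm w)" using p by (simp add: z_def divide_inverse mult.commute)
  have n: "1 - norm z = 1 / (1 + norm w)" unfolding nz using p by (simp add: field_simps)
  have "0 < 1 - norm z" unfolding n using p by simp
  then have "z \<in> ball 0 1" by simp
  moreover have "z /\<^sub>R (1 - norm z) = w" unfolding n using p by (simp add: z_def)
  then have "T h z = h w / (1 + norm w)" for h by (simp add: T_def n)
  then have "\<bar>T f z - T g z\<bar> = \<bar>f w - g w\<bar> / (1 + norm w)"
    using p by (simp flip: diff_divide_distrib)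
  ultimately show ?thesis using T_dist_upper[OF assms, of z] by simp
qed

text \<open>Choosing a point of a countable dense set within \<open>e\<close> of each
  \<open>F A\<close> is injective by the separation \<open>2 * e\<close>, which would embed the
  uncountable power set of the naturals in a countable set.\<close>

lemma (in Metric_space) not_separable_if_separated_family:
  assumes F: "\<And>A :: nat set. F A \<in> M" and e: "e > 0"
    and sep: "\<And>A B. A \<noteq> B \<Longrightarrow> 2 * e \<le> d (F A) (F B)"
  shows "\<not> separable_space mtopology"
proof
  assume "separable_space mtopology"
  then obtain C where C: "countable C" "C \<subseteq> M" "mtopology closure_of C = M"
    by (auto simp: separable_space_def)
  have "\<exists>y\<in>C. d (F A) y < e" for A
  proof -
    have "F A \<in> mtopology closure_of C" using C(3) F by simp
    then show ?thesis using e unfolding metric_closure_of by auto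
  qed
  then obtain y where y: "\<And>A. y A \<in> C" "\<And>A. d (F A) (y A) < e" by metis
  have "inj y"
  proof (rule injI, rule ccontr)
    fix A B assume eq: "y A = y B" and "A \<noteq> B"
    have "d (F A) (F B) \<le> d (F A) (y A) + d (y A) (F B)"
      using F y(1) C(2) by (intro triangle) auto
    also have "\<dots> < e + e" using y(2)[of A] y(2)[of B] by (simp add: eq commute)
    finally show False using sep[OF \<open>A \<noteq> B\<close>] by simp
  qed
  moreover have "countable (range y)" using y(1) by (intro countable_subset[OF _ C(1)]) auto
  ultimately have "countable (UNIV :: nat set set)" by (rule countable_image_inj_on[rotated])
  then have "range (from_nat_into (UNIV :: nat set set)) = UNIV" by (intro range_from_nat_into) auto
  then show False using Cantors_theorem[of "UNIV :: nat set"] by auto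
qed

theorem theorem3p1:
  shows "\<not> separable_space (Metric_space.mtopology
           (quasi_convex_linear_growth :: (real^2^2 \<Rightarrow> real) set) T_dist)"
proof -
  interpret Metric_space "quasi_convex_linear_growth :: (real^2^2 \<Rightarrow> real) set" T_dist
    by (rule Metric_space_T_dist)
  obtain C where C: "C > 0" and bound: "\<And>u :: real^2 \<Rightarrow> real^2. u \<in> cube_tests \<Longrightarrow>
    1/8 \<le> (LINT x:unit_cube|lborel. C * scalar_defect (jacobian_matrix u x) + max 0 (1/2 - \<bar>jacobian_matrix u x $ 1 $ 1\<bar>))"
    using bump_integral_bound by blast
  have C0: "0 \<le> C" using C by simp
  define n where "n = norm (mat 1 :: real^2^2)"
  \<comment> \<open>As \<open>mat (2 ^ k)\<close> has norm \<open>2 ^ k * n\<close> and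
    \<open>2 ^ k \<ge> 1\<close>, the quotient in \<open>T_dist_ge\<close> is at least
    \<open>1 / (8 * (1 + n)) = 2 * e\<close>, independently of \<open>k\<close>.\<close>
  define e where "e = 1 / (16 * (1 + n))"
  have n: "n \<ge> 0" by (simp add: n_def)
  define F where "F A = envelope (gap_integrand C A)" for A
  have F: "F A \<in> quasi_convex_linear_growth" for A
    unfolding F_def by (rule envelope_gap_integrand_in_space[OF C0])
  have growth: "linear_growth (F A)" for A using F[of A] by (simp add: quasi_convex_linear_growth_def)
  have sep: "2 * e \<le> T_dist (F A) (F B)" if "k \<in> A" "k \<notin> B" for A B k
  proof -
    have "mat (2 ^ k) = (2 ^ k) *\<^sub>R (mat 1 :: real^2^2)" by (simp add: vec_eq_iff mat_def)
    then have nk: "norm (mat (2 ^ k) :: real^2^2) = 2 ^ k * n" by (simp add: n_def)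
    have "1 + 2 ^ k * n \<le> 2 ^ k * (1 + n)" by (simp add: distrib_left)
    then have "(2 ^ k / 8) / (2 ^ k * (1 + n)) \<le> (2 ^ k / 8) / (1 + 2 ^ k * n)"
      using n by (intro divide_left_mono mult_pos_pos add_pos_nonneg) auto
    moreover have "2 * e = (2 ^ k / 8) / (2 ^ k * (1 + n))"
    proof -
      have "1 + n \<noteq> 0" using n by simp
      then show ?thesis unfolding e_def by (simp add: divide_simps)
    qed
    moreover have "(2 ^ k / 8) / (1 + 2 ^ k * n) \<le> \<bar>F A (mat (2 ^ k)) - F B (mat (2 ^ k))\<bar> / (1 + 2 ^ k * n)"
      using envelope_gap_integrand_ge[OF C0 that(1) bound] envelope_gap_integrand_eq_0[OF C0 that(2)] n
      by (intro divide_right_mono) (auto simp: F_def)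
    ultimately show ?thesis
      using T_dist_ge[OF growth growth, of A "mat (2 ^ k)" B] by (simp add: nk)
  qed
  have sep': "2 * e \<le> T_dist (F A) (F B)" if AB: "A \<noteq> B" for A B
  proof -
    consider k where "k \<in> A" "k \<notin> B" | k where "k \<in> B" "k \<notin> A" using AB by blast
    then show ?thesis
    proof cases
      case 2
      then have "2 * e \<le> T_dist (F B) (F A)" by (rule sep)
      then show ?thesis by (simp only: commute)
    qed (rule sep)
  qed
  have "e > 0" using n by (simp add: e_def)
  from not_separable_if_separated_family[OF F this sep'] show ?thesis .
qed

end
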